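(* For $n\ge2$ and $w\in S_n$, $$\mathcal G^{A_{n-1}}_w(a,b)=\sum_{\mathbf D\in\mathrm{RSub}(\Delta^A_{n-1},w)}\mathrm{Wt}(\mathbf D),\qquad \mathrm{Wt}(\mathbf D)=\prod_{d\in\mathbf D}\mathrm{wt}(d)\times\prod_{d\in B(\mathbf D)}\big(1+\beta\,\mathrm{wt}(d)\big).$$
   Context: Let $\beta$ be an indeterminate, $x\oplus y=x+y+\beta xy$, $\bar x=-x/(1+\beta x)$. $\mathrm{Id}_\beta(S_n)$ is the $\mathbb Z[\beta]$-algebra generated by $u_1,\dots,u_{n-1}$ with $u_i^2=\beta u_i$, $u_iu_j=u_ju_i$ ($|i-j|>1$), $u_iu_{i+1}u_i=u_{i+1}u_iu_{i+1}$; $u_w=u_{i_1}\cdots u_{i_\ell}$ for a reduced word of $w$. Variables commute with $u_i$; $h_i(x)=1+xu_i$, $A^{(n)}_i(x)=h_{n-1}(x)\cdots h_i(x)$, $G_{A_{n-1}}(a_1,\dots,a_{n-1})=A^{(n)}_1(a_1)\cdots A^{(n)}_{n-1}(a_{n-1})$. $\mathcal G^{A_{n-1}}_w(a,b)$ is the coefficient of $u_w$ in $G_{A_{n-1}}(\bar b_1,\dots,\bar b_{n-1})^{-1}G_{A_{n-1}}(a_1,\dots,a_{n-1})$. $\Delta^A_{n-1}=(d_1,\dots,d_N)$, $N=n(n-1)/2$, is the sequence of boxes at positions $(i,j)$ with $i,j\ge1$, $i+j\le n$, listed for $j=n-1,n-2,\dots,1$ and, for each $j$, $i=1,\dots,n-j$;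 the box at $(i,j)$ carries the simple reflection $s_{i+j-1}$ and weight $\mathrm{wt}=a_i\oplus b_j$ (so as a word $\Delta^A_{n-1}=(s_{n-1}\,|\,s_{n-2},s_{n-1}\,|\,\cdots\,|\,s_1,\dots,s_{n-1})$). For a sequence $\Delta=(d_1,\dots,d_N)$ of simple reflections and $w$ of length $\ell$, $\mathrm{RSub}(\Delta,w)$ is the set of subsequences $\mathbf D=(d_{j_1},\dots,d_{j_\ell})$, $j_1<\dots<j_\ell$, with $d_{j_1}\cdots d_{j_\ell}=w$ (so a reduced word). Setting $j_{\ell+1}=N+1$, $B(\mathbf D)$ is the set of positions $j\le N$ with $j_p<j<j_{p+1}$ for some $p$ such that $(d_{j_1}\cdots d_{j_p})\star d_j=d_{j_1}\cdots d_{j_p}$, where $\star$ is the Demazure product ($u_yu_z=\beta^{\ell(y)+\ell(z)-\ell(y\star z)}u_{y\star z}$); equivalently $\ell(d_{j_1}\cdots d_{j_p}d_j)<\ell(d_{j_1}\cdots d_{j_p})$. *)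

theory Defs
  imports
    "HOL-Algebra.QuotRing"
    "HOL-Combinatorics.Permutations"
    "HOL-Computational_Algebra.Fraction_Field"
    "HOL-Library.Poly_Mapping"
begin

text \<open>Elements of \<open>S_n\<close> are the functions \<open>w\<close> with \<^prop>\<open>w permutes {1..n}\<close>; the group
  product is composition of functions, and a word in the simple reflections is
  the list of their indices.\<close>

definition simple_refl :: "nat \<Rightarrow> nat \<Rightarrow> nat" where
  "simple_refl i = transpose i (Suc i)"

definition word_prod :: "nat list \<Rightarrow> nat \<Rightarrow> nat" where
  "word_prod is = foldr (\<circ>) (map simple_refl is) id"

definition len :: "nat \<Rightarrow> (nat \<Rightarrow> nat) \<Rightarrow> nat" where
  "len n w = (LEAST l. \<exists>is. set is \<subseteq> {1..<n} \<and> length is = l \<and> word_prod is = w)"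

definition reduced_word :: "nat \<Rightarrow> (nat \<Rightarrow> nat) \<Rightarrow> nat list \<Rightarrow> bool" where
  "reduced_word n w is \<longleftrightarrow> set is \<subseteq> {1..<n} \<and> word_prod is = w \<and> length is = len n w"

datatype 'g fmon = FMon (letters: "'g list")

instantiation fmon :: (type) monoid_add
begin

definition zero_fmon :: "'a fmon" where
  "0 = FMon []"

definition plus_fmon :: "'a fmon \<Rightarrow> 'a fmon \<Rightarrow> 'a fmon" where
  "x + y = FMon (letters x @ letters y)"

instance
  by standard (simp_all add: zero_fmon_def plus_fmon_def)

end

text \<open>Poly mappings multiply by convolution over an additively written monoid of exponents.
  With the free monoid of words (concatenation as \<open>+\<close>) as exponents,
  the type \<^typ>\<open>'g fmon \<Rightarrow>\<^sub>0 'r\<close> is the free associative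
  algebra over \<^typ>\<open>'r\<close> on the generators \<^typ>\<open>'g\<close>.\<close>

abbreviation free_scal :: "'r::comm_ring_1 \<Rightarrow> nat fmon \<Rightarrow>\<^sub>0 'r" where
  "free_scal c \<equiv> Poly_Mapping.single 0 c"

abbreviation free_gen :: "nat \<Rightarrow> nat fmon \<Rightarrow>\<^sub>0 'r::comm_ring_1" where
  "free_gen i \<equiv> Poly_Mapping.single (FMon [i]) 1"

text \<open>The free algebra on the generators \<open>u\<^sub>1, \<dots>, u\<^sub>n\<^sub>-\<^sub>1\<close> only.\<close>

definition free_alg :: "nat \<Rightarrow> (nat fmon \<Rightarrow>\<^sub>0 'r::comm_ring_1) ring" where
  "free_alg n =
    \<lparr>carrier = {p. \<forall>m \<in> Poly_Mapping.keys p. set (letters m) \<subseteq> {1..<n}},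
      monoid.mult = (*), one = 1, zero = 0, add = (+)\<rparr>"

definition id_relations :: "'r::comm_ring_1 \<Rightarrow> nat \<Rightarrow> (nat fmon \<Rightarrow>\<^sub>0 'r) set" where
  "id_relations \<beta> n =
     {free_gen i * free_gen i - free_scal \<beta> * free_gen i | i. i \<in> {1..<n}} \<union>
     {free_gen i * free_gen j - free_gen j * free_gen i | i j.
        i \<in> {1..<n} \<and> j \<in> {1..<n} \<and> \<bar>int i - int j\<bar> > 1} \<union>
     {free_gen i * free_gen (i + 1) * free_gen i
        - free_gen (i + 1) * free_gen i * free_gen (i + 1) | i.
        i \<in> {1..<n} \<and> i + 1 \<in> {1..<n}}"

definition id_ideal :: "'r::comm_ring_1 \<Rightarrow> nat \<Rightarrow> (nat fmon \<Rightarrow>\<^sub>0 'r) set" where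
  "id_ideal \<beta> n = Idl\<^bsub>free_alg n\<^esub> (id_relations \<beta> n)"

text \<open>The algebra is defined over an arbitrary commutative ring with a distinguished
  element \<open>\<beta>\<close>. Taking the ring to be a field of rational functions extends the scalars
  of the \<open>\<int>[\<beta>]\<close>-algebra \<open>Id\<^sub>\<beta>(S_n)\<close> by variables that commute with the \<open>u\<^sub>i\<close>.\<close>

definition id_alg :: "'r::comm_ring_1 \<Rightarrow> nat \<Rightarrow> (nat fmon \<Rightarrow>\<^sub>0 'r) set ring" where
  "id_alg \<beta> n = free_alg n Quot id_ideal \<beta> n"

definition to_alg :: "'r::comm_ring_1 \<Rightarrow> nat \<Rightarrow> (nat fmon \<Rightarrow>\<^sub>0 'r) \<Rightarrow> (nat fmon \<Rightarrow>\<^sub>0 'r) set" where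
  "to_alg \<beta> n p = id_ideal \<beta> n +>\<^bsub>free_alg n\<^esub> p"

definition scal :: "'r::comm_ring_1 \<Rightarrow> nat \<Rightarrow> 'r \<Rightarrow> (nat fmon \<Rightarrow>\<^sub>0 'r) set" where
  "scal \<beta> n c = to_alg \<beta> n (free_scal c)"

definition gen :: "'r::comm_ring_1 \<Rightarrow> nat \<Rightarrow> nat \<Rightarrow> (nat fmon \<Rightarrow>\<^sub>0 'r) set" where
  "gen \<beta> n i = to_alg \<beta> n (free_gen i)"

definition ring_prod_list :: "('a, 'b) ring_scheme \<Rightarrow> 'a list \<Rightarrow> 'a" where
  "ring_prod_list R xs = foldr (\<otimes>\<^bsub>R\<^esub>) xs \<one>\<^bsub>R\<^esub>"

text \<open>By the braid relations and Matsumoto's theorem the choice of the reduced word is immaterial.\<close>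

definition basis_elt :: "'r::comm_ring_1 \<Rightarrow> nat \<Rightarrow> (nat \<Rightarrow> nat) \<Rightarrow> (nat fmon \<Rightarrow>\<^sub>0 'r) set" where
  "basis_elt \<beta> n w =
     ring_prod_list (id_alg \<beta> n) (map (gen \<beta> n) (SOME is. reduced_word n w is))"

text \<open>The unique expansion \<open>x = \<Sum>\<^sub>v c\<^sub>v u\<^sub>v\<close> over \<open>v \<in> S_n\<close>;
  uniqueness as a function requires fixing \<open>c\<close> outside \<open>S_n\<close>.\<close>

definition alg_coeff ::
  "'r::comm_ring_1 \<Rightarrow> nat \<Rightarrow> (nat fmon \<Rightarrow>\<^sub>0 'r) set \<Rightarrow> (nat \<Rightarrow> nat) \<Rightarrow> 'r" where
  "alg_coeff \<beta> n x =
     (THE c. (\<forall>v. \<not> v permutes {1..n} \<longrightarrow> c v = 0) \<and>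
        x = (\<Oplus>\<^bsub>id_alg \<beta> n\<^esub>v \<in> {v. v permutes {1..n}}.
               scal \<beta> n (c v) \<otimes>\<^bsub>id_alg \<beta> n\<^esub> basis_elt \<beta> n v))"

text \<open>The Demazure product \<open>y \<star> z\<close>, determined by
  \<open>u\<^sub>y u\<^sub>z = \<beta>\<^bsup>\<ell>(y) + \<ell>(z) - \<ell>(y \<star> z)\<^esup> u\<^bsub>y \<star> z\<^esub>\<close>. This pins down a unique
  element only when the powers of \<open>\<beta>\<close> do not vanish, e.g. for an indeterminate \<open>\<beta>\<close>.\<close>

definition demazure ::
  "'r::comm_ring_1 \<Rightarrow> nat \<Rightarrow> (nat \<Rightarrow> nat) \<Rightarrow> (nat \<Rightarrow> nat) \<Rightarrow> nat \<Rightarrow> nat" where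
  "demazure \<beta> n y z =
     (THE v. v permutes {1..n} \<and> len n v \<le> len n y + len n z \<and>
        basis_elt \<beta> n y \<otimes>\<^bsub>id_alg \<beta> n\<^esub> basis_elt \<beta> n z =
          scal \<beta> n (\<beta> ^ (len n y + len n z - len n v)) \<otimes>\<^bsub>id_alg \<beta> n\<^esub> basis_elt \<beta> n v)"

definition fgl_plus :: "'r::field \<Rightarrow> 'r \<Rightarrow> 'r \<Rightarrow> 'r" where
  "fgl_plus \<beta> x y = x + y + \<beta> * x * y"

definition fgl_neg :: "'r::field \<Rightarrow> 'r \<Rightarrow> 'r" where
  "fgl_neg \<beta> x = - x / (1 + \<beta> * x)"

definition h_elt :: "'r::field \<Rightarrow> nat \<Rightarrow> nat \<Rightarrow> 'r \<Rightarrow> (nat fmon \<Rightarrow>\<^sub>0 'r) set" where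
  "h_elt \<beta> n i x =
     \<one>\<^bsub>id_alg \<beta> n\<^esub> \<oplus>\<^bsub>id_alg \<beta> n\<^esub> (scal \<beta> n x \<otimes>\<^bsub>id_alg \<beta> n\<^esub> gen \<beta> n i)"

definition A_elt :: "'r::field \<Rightarrow> nat \<Rightarrow> nat \<Rightarrow> 'r \<Rightarrow> (nat fmon \<Rightarrow>\<^sub>0 'r) set" where
  "A_elt \<beta> n i x = ring_prod_list (id_alg \<beta> n) (map (\<lambda>k. h_elt \<beta> n k x) (rev [i..<n]))"

definition G_elt :: "'r::field \<Rightarrow> nat \<Rightarrow> (nat \<Rightarrow> 'r) \<Rightarrow> (nat fmon \<Rightarrow>\<^sub>0 'r) set" where
  "G_elt \<beta> n a = ring_prod_list (id_alg \<beta> n) (map (\<lambda>i. A_elt \<beta> n i (a i)) [1..<n])"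

definition double_grothendieck ::
  "'r::field \<Rightarrow> nat \<Rightarrow> (nat \<Rightarrow> nat) \<Rightarrow> (nat \<Rightarrow> 'r) \<Rightarrow> (nat \<Rightarrow> 'r) \<Rightarrow> 'r" where
  "double_grothendieck \<beta> n w a b =
     alg_coeff \<beta> n
       (inv\<^bsub>id_alg \<beta> n\<^esub> (G_elt \<beta> n (\<lambda>i. fgl_neg \<beta> (b i))) \<otimes>\<^bsub>id_alg \<beta> n\<^esub> G_elt \<beta> n a) w"

definition Delta :: "nat \<Rightarrow> (nat \<times> nat) list" where
  "Delta n = concat (map (\<lambda>j. map (\<lambda>i. (i, j)) [1..<Suc (n - j)]) (rev [1..<n]))"

definition box_index :: "nat \<times> nat \<Rightarrow> nat" where
  "box_index = (\<lambda>(i, j). i + j - 1)"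

definition box_wt :: "'r::field \<Rightarrow> (nat \<Rightarrow> 'r) \<Rightarrow> (nat \<Rightarrow> 'r) \<Rightarrow> nat \<times> nat \<Rightarrow> 'r" where
  "box_wt \<beta> a b = (\<lambda>(i, j). fgl_plus \<beta> (a i) (b j))"

text \<open>A subsequence \<open>D\<close> of a sequence of boxes is given by its strictly increasing list
  \<open>js\<close> of positions; positions are counted from \<open>0\<close>.\<close>

definition sub_prod :: "(nat \<times> nat) list \<Rightarrow> nat list \<Rightarrow> nat \<Rightarrow> nat" where
  "sub_prod ds js = word_prod (map (\<lambda>j. box_index (ds ! j)) js)"

definition RSub :: "nat \<Rightarrow> (nat \<times> nat) list \<Rightarrow> (nat \<Rightarrow> nat) \<Rightarrow> nat list set" where
  "RSub n ds w =
     {js. sorted_wrt (<) js \<and> set js \<subseteq> {..<length ds} \<and>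
          length js = len n w \<and> sub_prod ds js = w}"

definition B_set :: "'r::field \<Rightarrow> nat \<Rightarrow> (nat \<times> nat) list \<Rightarrow> nat list \<Rightarrow> nat set" where
  "B_set \<beta> n ds js =
     {j. j < length ds \<and>
         (\<exists>p < length js. js ! p < j \<and> j < (js @ [length ds]) ! Suc p \<and>
            demazure \<beta> n (sub_prod ds (take (Suc p) js)) (simple_refl (box_index (ds ! j)))
              = sub_prod ds (take (Suc p) js))}"

definition sub_Wt ::
  "'r::field \<Rightarrow> nat \<Rightarrow> (nat \<Rightarrow> 'r) \<Rightarrow> (nat \<Rightarrow> 'r) \<Rightarrow> (nat \<times> nat) list \<Rightarrow> nat list \<Rightarrow> 'r" where
  "sub_Wt \<beta> n a b ds js =
     (\<Prod>j \<in> set js. box_wt \<beta> a b (ds ! j)) *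
     (\<Prod>j \<in> B_set \<beta> n ds js. 1 + \<beta> * box_wt \<beta> a b (ds ! j))"

text \<open>The field of rational functions over \<open>\<int>\<close> in countably many variables \<open>x\<^sub>0, x\<^sub>1, \<dots>\<close>: the
  inner poly mappings are the exponent vectors of monomials. The variables are shared out as
  \<open>\<beta> = x\<^sub>0\<close>, \<open>a\<^sub>i = x\<^bsub>2i+1\<^esub>\<close> and \<open>b\<^sub>j = x\<^bsub>2j+2\<^esub>\<close>.\<close>

type_synonym rat_fun = "((nat \<Rightarrow>\<^sub>0 nat) \<Rightarrow>\<^sub>0 int) fract"

definition indet :: "nat \<Rightarrow> rat_fun" where
  "indet k = Fract (Poly_Mapping.single (Poly_Mapping.single k 1) 1) 1"

definition beta :: rat_fun where
  "beta = indet 0"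

definition avar :: "nat \<Rightarrow> rat_fun" where
  "avar i = indet (2 * i + 1)"

definition bvar :: "nat \<Rightarrow> rat_fun" where
  "bvar j = indet (2 * j + 2)"

end

theory Submission
  imports Defs
begin

text \<open>The right action of the generators on functions on permutations, in which \<open>u\<^sub>i\<close> sends the
  indicator of \<open>w\<close> to that of \<open>w s\<^sub>i\<close> at an ascent and multiplies it by \<open>\<beta>\<close> at a descent, respects
  the defining relations; applied to the indicator of the identity it shows that the
  \<open>u\<^sub>w\<close> are linearly independent. With \<open>B\<^sub>j(y) = h\<^sub>j(y) \<cdots> h\<^bsub>n-1\<^esub>(y)\<close>, the inverse of \<open>A\<^sub>j\<close> at the formal
  negative of \<open>y\<close>, the Yang-Baxter relation gives
  \<open>B\<^sub>j(y) A\<^sub>j(x) = A\<^bsub>j+1\<^esub>(x) h\<^sub>j(x \<oplus> y) B\<^bsub>j+1\<^esub>(y)\<close>. Moving the factors \<open>B\<^sub>j(b\<^sub>j)\<close> one after another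
  through \<open>G(a)\<close> turns \<open>G\<^sup>-\<^sup>1 G\<close> into the product over the boxes of \<open>\<Delta>\<close> of
  the factors \<open>1 + wt(d) u\<^sub>d\<close>. Multiplying by one more such factor changes the coefficients exactly
  as the sum over subwords: at an ascent the factor \<open>wt\<close> lengthens the word, at a
  descent \<open>u\<^sub>w (1 + wt u\<^sub>d) = (1 + \<beta> wt) u\<^sub>w\<close>.\<close>

section \<open>Reduced words in the symmetric group\<close>

lemma word_prod_Nil [simp]: "word_prod [] = id"
  by (simp add: word_prod_def)

lemma word_prod_Cons [simp]: "word_prod (i # xs) = simple_refl i \<circ> word_prod xs"
  by (simp add: word_prod_def)

lemma word_prod_append [simp]: "word_prod (xs @ ys) = word_prod xs \<circ> word_prod ys"
  by (induction xs) (simp_all add: comp_assoc)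

lemma word_prod_snoc: "word_prod (xs @ [i]) = word_prod xs \<circ> simple_refl i"
  by (simp add: fun_eq_iff)

lemma simple_refl_simps [simp]:
  "simple_refl i i = Suc i" "simple_refl i (Suc i) = i"
  "j \<noteq> i \<Longrightarrow> j \<noteq> Suc i \<Longrightarrow> simple_refl i j = j"
  by (simp_all add: simple_refl_def)

lemma simple_refl_involutory [simp]: "simple_refl i (simple_refl i j) = j"
  by (simp add: simple_refl_def)

lemma simple_refl_comp_self [simp]: "simple_refl i \<circ> simple_refl i = id"
  by (simp add: simple_refl_def)

lemma comp_simple_refl_self [simp]: "w \<circ> simple_refl i \<circ> simple_refl i = w"
  by (simp add: comp_assoc)

lemma simple_refl_commute:
  "\<bar>int i - int j\<bar> > 1 \<Longrightarrow> simple_refl i \<circ> simple_refl j = simple_refl j \<circ> simple_refl i"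
  by (auto simp: fun_eq_iff simple_refl_def transpose_def)

lemma simple_refl_braid:
  "simple_refl i \<circ> simple_refl (Suc i) \<circ> simple_refl i
    = simple_refl (Suc i) \<circ> simple_refl i \<circ> simple_refl (Suc i)"
  by (auto simp: fun_eq_iff simple_refl_def transpose_def)

lemma simple_refl_permutes: "i \<in> {1..<n} \<Longrightarrow> simple_refl i permutes {1..n}"
  unfolding simple_refl_def by (rule permutes_swap_id) auto

lemma permutes_comp_simple_refl:
  "w permutes {1..n} \<Longrightarrow> i \<in> {1..<n} \<Longrightarrow> w \<circ> simple_refl i permutes {1..n}"
  by (rule permutes_compose[OF simple_refl_permutes])

lemma word_prod_permutes: "set xs \<subseteq> {1..<n} \<Longrightarrow> word_prod xs permutes {1..n}"
proof (induction xs)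
  case (Cons i xs)
  then show ?case
    unfolding word_prod_Cons by (intro permutes_compose simple_refl_permutes) simp_all
qed (simp add: permutes_id)

lemma permutes_neq_Suc: "w permutes A \<Longrightarrow> w i \<noteq> w (Suc i)"
  by (metis n_not_Suc_n permutes_inj injD)

section \<open>Inversions and the length function\<close>

definition inversions :: "nat \<Rightarrow> (nat \<Rightarrow> nat) \<Rightarrow> (nat \<times> nat) set" where
  "inversions n w = {(p, q). 1 \<le> p \<and> p < q \<and> q \<le> n \<and> w q < w p}"

lemma card_inversions_id [simp]: "card (inversions n id) = 0"
proof -
  have "inversions n id = {}" by (auto simp: inversions_def)
  then show ?thesis by (metis card.empty)
qed

lemma finite_inversions: "finite (inversions n w)"
  by (rule finite_subset[of _ "{..n} \<times> {..n}"]) (auto simp: inversions_def)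

text \<open>Right multiplication by \<open>simple_refl i\<close> swaps the entries at two adjacent
  positions. Applying it to both positions of a pair keeps their order unless the pair is (i, i+1),
  so only that pair changes status, and at an ascent it becomes an inversion.\<close>

lemma inversions_comp_simple_refl:
  assumes i: "i \<in> {1..<n}" and up: "w i < w (Suc i)"
  shows "inversions n (w \<circ> simple_refl i)
    = insert (i, Suc i) (map_prod (simple_refl i) (simple_refl i) ` inversions n w)"
    (is "?L = insert _ (?g ` ?R)")
proof (intro equalityI subsetI)
  fix z assume z: "z \<in> ?L"
  obtain p q where [simp]: "z = (p, q)" by fastforce
  show "z \<in> insert (i, Suc i) (?g ` ?R)"
  proof (cases "z = (i, Suc i)")
    case False
    have "?g z \<in> ?R"
      using z False i up
      by (auto simp: inversions_def simple_refl_def transpose_def split: if_splits)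
    moreover have "z = ?g (?g z)" by simp
    ultimately show ?thesis by blast
  qed simp
next
  fix z assume "z \<in> insert (i, Suc i) (?g ` ?R)"
  then show "z \<in> ?L"
    using i up
    by (auto simp: inversions_def simple_refl_def transpose_def split: if_splits)
qed

lemma card_inversions_ascent:
  assumes i: "i \<in> {1..<n}" and up: "w i < w (Suc i)"
  shows "card (inversions n (w \<circ> simple_refl i)) = Suc (card (inversions n w))"
proof -
  let ?g = "map_prod (simple_refl i) (simple_refl i)"
  have inj: "inj ?g"
    by (rule prod.inj_map) (metis injI simple_refl_involutory)+
  have "(i, Suc i) \<notin> ?g ` inversions n w"
  proof
    assume "(i, Suc i) \<in> ?g ` inversions n w"
    then obtain p q where pq: "(p, q) \<in> inversions n w" "(i, Suc i) = (simple_refl i p, simple_refl i q)"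
      by auto
    then have "p = Suc i" "q = i"
      by (metis prod.inject simple_refl_involutory simple_refl_simps(1,2))+
    with pq show False by (simp add: inversions_def)
  qed
  then show ?thesis
    unfolding inversions_comp_simple_refl[OF assms]
    by (simp add: card_image[OF inj_on_subset[OF inj subset_UNIV]] finite_inversions)
qed

lemma card_inversions_descent:
  assumes i: "i \<in> {1..<n}" and down: "w (Suc i) < w i"
  shows "card (inversions n w) = Suc (card (inversions n (w \<circ> simple_refl i)))"
  using card_inversions_ascent[of i n "w \<circ> simple_refl i"] assms by simp

text \<open>Without descents \<open>w\<close> increases along {1..n}, hence
  \<open>k \<le> w k\<close> for every k there, and a permutation that lowers no point is the
  identity.\<close>

lemma no_descent_imp_id:
  assumes w: "w permutes {1..n}" and "\<And>i. i \<in> {1..<n} \<Longrightarrow> \<not> w (Suc i) < w i"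
  shows "w = id"
proof (rule permutes_natset_ge[OF w], rule ballI)
  have step: "w i < w (Suc i)" if "i \<in> {1..<n}" for i
    using assms(2)[OF that] permutes_neq_Suc[OF w, of i] by simp
  fix k assume "k \<in> {1..n}"
  then show "k \<le> w k"
  proof (induction k)
    case (Suc k)
    show ?case
    proof (cases "k = 0")
      case True
      then show ?thesis using permutes_in_image[OF w, of "Suc k"] Suc.prems by simp
    next
      case False
      then show ?thesis using Suc step[of k] by simp
    qed
  qed simp
qed

text \<open>Each letter changes the number of inversions by exactly one, up or down. This is the
  lower bound for the length.\<close>

lemma card_inversions_word_prod:
  "set xs \<subseteq> {1..<n} \<Longrightarrow> card (inversions n (word_prod xs)) \<le> length xs"
proof (induction xs rule: rev_induct)
  case Nil
  then show ?case by (simp del: id_apply)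
next
  case (snoc i xs)
  let ?w = "word_prod xs"
  have i: "i \<in> {1..<n}" and w: "?w permutes {1..n}"
    using snoc.prems word_prod_permutes[of xs n] by auto
  have le: "card (inversions n ?w) \<le> length xs"
    using snoc by simp
  show ?case
  proof (cases "?w i < ?w (Suc i)")
    case True
    then show ?thesis
      unfolding word_prod_snoc card_inversions_ascent[OF i True] using le by simp
  next
    case False
    then have "?w (Suc i) < ?w i" using permutes_neq_Suc[OF w, of i] by simp
    from card_inversions_descent[OF i this] le show ?thesis
      unfolding word_prod_snoc length_append_singleton by linarith
  qed
qed

text \<open>Cancelling a descent removes exactly one inversion, and a permutation other than the
  identity has a descent. This is the upper bound for the length.\<close>

lemma ex_word_inversions:
  assumes "w permutes {1..n}"
  shows "\<exists>xs. set xs \<subseteq> {1..<n} \<and> length xs = card (inversions n w) \<and> word_prod xs = w"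
  using assms
proof (induction "card (inversions n w)" arbitrary: w)
  case 0
  then have "inversions n w = {}" using finite_inversions by simp
  then have "w = id" by (intro no_descent_imp_id[OF 0(2)]) (auto simp: inversions_def)
  with 0(1) show ?case by (intro exI[of _ "[]"]) simp
next
  case (Suc l)
  have "\<exists>i \<in> {1..<n}. w (Suc i) < w i"
  proof (rule ccontr)
    assume "\<not> ?thesis"
    then have "w = id" by (intro no_descent_imp_id[OF Suc.prems]) blast
    with Suc(2) show False by simp
  qed
  then obtain i where i: "i \<in> {1..<n}" "w (Suc i) < w i" by blast
  from card_inversions_descent[OF i] Suc(2) have l: "l = card (inversions n (w \<circ> simple_refl i))"
    by simp
  from Suc(1)[OF l permutes_comp_simple_refl[OF Suc.prems i(1)]] obtain xs
    where xs: "set xs \<subseteq> {1..<n}" "length xs = l" "word_prod xs = w \<circ> simple_refl i"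
    using l by auto
  show ?case
    using xs i Suc(2) by (intro exI[of _ "xs @ [i]"]) simp
qed

lemma len_eq_card_inversions:
  assumes "w permutes {1..n}"
  shows "len n w = card (inversions n w)"
  unfolding len_def
proof (rule Least_equality)
  show "\<exists>xs. set xs \<subseteq> {1..<n} \<and> length xs = card (inversions n w) \<and> word_prod xs = w"
    by (rule ex_word_inversions[OF assms])
next
  fix l assume "\<exists>xs. set xs \<subseteq> {1..<n} \<and> length xs = l \<and> word_prod xs = w"
  then show "card (inversions n w) \<le> l" using card_inversions_word_prod by blast
qed

lemma len_ascent:
  assumes "w permutes {1..n}" "i \<in> {1..<n}" "w i < w (Suc i)"
  shows "len n (w \<circ> simple_refl i) = Suc (len n w)"
  using card_inversions_ascent[OF assms(2,3)] assms(1)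
    permutes_comp_simple_refl[OF assms(1,2)]
  by (simp only: len_eq_card_inversions)

lemma len_descent:
  assumes "w permutes {1..n}" "i \<in> {1..<n}" "w (Suc i) < w i"
  shows "len n w = Suc (len n (w \<circ> simple_refl i))"
  using len_ascent[OF permutes_comp_simple_refl[OF assms(1,2)] assms(2)] assms(3) by simp

lemma len_id [simp]: "len n id = 0"
  using len_eq_card_inversions[OF permutes_id, of n] by simp

lemma len_eq_0_iff: "w permutes {1..n} \<Longrightarrow> len n w = 0 \<longleftrightarrow> w = id"
  using ex_word_inversions[of w n] by (auto simp: len_eq_card_inversions)

lemma len_word_prod_le: "set xs \<subseteq> {1..<n} \<Longrightarrow> len n (word_prod xs) \<le> length xs"
  using card_inversions_word_prod len_eq_card_inversions[OF word_prod_permutes] by metis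

lemma ex_reduced_word: "w permutes {1..n} \<Longrightarrow> \<exists>xs. reduced_word n w xs"
  unfolding reduced_word_def using ex_word_inversions len_eq_card_inversions by metis

lemma reduced_word_letters: "reduced_word n w xs \<Longrightarrow> set xs \<subseteq> {1..<n}"
  by (simp add: reduced_word_def)

lemma reduced_word_permutes: "reduced_word n w xs \<Longrightarrow> w permutes {1..n}"
  unfolding reduced_word_def using word_prod_permutes by blast

text \<open>If the last letter were an ascent of \<open>w\<close>, cancelling it would give an
  element longer than \<open>w\<close>, yet spelled by the shorter word \<open>xs\<close>. All later
  inductions over reduced words and subwords remove the last letter in this way.\<close>

lemma reduced_word_snoc:
  assumes w: "w permutes {1..n}"
  shows "reduced_word n w (xs @ [i]) \<longleftrightarrow>
    i \<in> {1..<n} \<and> w (Suc i) < w i \<and> reduced_word n (w \<circ> simple_refl i) xs" (is "?L \<longleftrightarrow> ?R")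
proof
  assume L: ?L
  then have i: "i \<in> {1..<n}" and xs: "set xs \<subseteq> {1..<n}" and eq: "word_prod xs = w \<circ> simple_refl i"
    by (auto simp: reduced_word_def)
  have "w (Suc i) < w i"
  proof (rule ccontr)
    assume "\<not> w (Suc i) < w i"
    then have "w i < w (Suc i)" using permutes_neq_Suc[OF w, of i] by simp
    from len_ascent[OF w i this] have "len n (word_prod xs) = Suc (len n w)" by (simp add: eq)
    with len_word_prod_le[OF xs] L show False by (simp add: reduced_word_def)
  qed
  with i xs eq len_descent[OF w i] L show ?R by (simp add: reduced_word_def)
next
  assume ?R
  then show ?L using len_descent[OF w] by (auto simp: reduced_word_def)
qed

section \<open>The quotient algebra\<close>

lemma ring_prod_list_Nil [simp]: "ring_prod_list R [] = \<one>\<^bsub>R\<^esub>"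
  by (simp add: ring_prod_list_def)

lemma ring_prod_list_Cons [simp]: "ring_prod_list R (x # xs) = x \<otimes>\<^bsub>R\<^esub> ring_prod_list R xs"
  by (simp add: ring_prod_list_def)

lemma (in ring) ring_prod_list_closed [simp, intro]:
  "set xs \<subseteq> carrier R \<Longrightarrow> ring_prod_list R xs \<in> carrier R"
  by (induction xs) auto

lemma (in ring) ring_prod_list_append:
  "set xs \<subseteq> carrier R \<Longrightarrow> set ys \<subseteq> carrier R \<Longrightarrow>
    ring_prod_list R (xs @ ys) = ring_prod_list R xs \<otimes> ring_prod_list R ys"
  by (induction xs) (auto simp: m_assoc)

text \<open>The product telescopes from the middle outwards. The other side of an inverse comes from
  the same lemma with the roles of \<open>f\<close> and \<open>g\<close> exchanged and the list
  reversed.\<close>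

lemma (in ring) ring_prod_list_inverse:
  assumes "\<And>x. x \<in> set xs \<Longrightarrow> f x \<in> carrier R" "\<And>x. x \<in> set xs \<Longrightarrow> g x \<in> carrier R"
    and "\<And>x. x \<in> set xs \<Longrightarrow> f x \<otimes> g x = \<one>"
  shows "ring_prod_list R (map f xs) \<otimes> ring_prod_list R (map g (rev xs)) = \<one>"
  using assms
proof (induction xs)
  case (Cons x xs)
  let ?P = "ring_prod_list R (map f xs)" and ?Q = "ring_prod_list R (map g (rev xs))"
  have c: "f x \<in> carrier R" "g x \<in> carrier R" "?P \<in> carrier R" "?Q \<in> carrier R"
    using Cons.prems(1,2) by (auto intro!: ring_prod_list_closed)
  have "ring_prod_list R (map g (rev (x # xs))) = ?Q \<otimes> g x"
    using Cons.prems(2) c by (subst rev.simps, simp, subst ring_prod_list_append) auto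
  then have "ring_prod_list R (map f (x # xs)) \<otimes> ring_prod_list R (map g (rev (x # xs)))
      = f x \<otimes> (?P \<otimes> ?Q) \<otimes> g x"
    using c by (simp add: m_assoc)
  also have "?P \<otimes> ?Q = \<one>"
    using Cons by simp
  finally show ?case using c Cons.prems(3) by simp
qed simp

text \<open>A new entry at a fresh key amounts to adding a single term, so additive statements about
  the free algebra reduce to monomials.\<close>

lemma poly_mapping_single_sum_induct [case_names single sum]:
  fixes p :: "'a \<Rightarrow>\<^sub>0 'b::comm_monoid_add"
  assumes "\<And>k c. P (Poly_Mapping.single k c)" "\<And>p q. P p \<Longrightarrow> P q \<Longrightarrow> P (p + q)"
  shows "P p"
proof (induction p rule: Poly_Mapping.update_induct)
  case const
  \<comment> \<open>The zero mapping is a single term with coefficient 0, so it needs no case of its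
    own.\<close>
  show ?case using assms(1)[of undefined 0] by simp
next
  case (update f a b)
  have "Poly_Mapping.update a b f = f + Poly_Mapping.single a b"
    using update(1)
    by (intro poly_mapping_eqI)
      (auto simp: Poly_Mapping.lookup_update lookup_add lookup_single in_keys_iff when_def)
  then show ?case using assms update by simp
qed

section \<open>The free algebra and its ideal of relations\<close>

lemma plus_FMon [simp]: "FMon xs + FMon ys = FMon (xs @ ys)"
  by (simp add: plus_fmon_def)

abbreviation free_word :: "nat list \<Rightarrow> nat fmon \<Rightarrow>\<^sub>0 'r::comm_ring_1" where
  "free_word xs \<equiv> Poly_Mapping.single (FMon xs) 1"

lemma free_scal_commute: "p * free_scal c = free_scal c * p"
  by (induction p rule: poly_mapping_single_sum_induct) (simp_all add: mult_single algebra_simps)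

lemma carrier_free_alg: "carrier (free_alg n) = {p. \<forall>m \<in> Poly_Mapping.keys p. set (letters m) \<subseteq> {1..<n}}"
  and mult_free_alg [simp]: "p \<otimes>\<^bsub>free_alg n\<^esub> q = p * q"
  and one_free_alg [simp]: "\<one>\<^bsub>free_alg n\<^esub> = 1"
  and zero_free_alg [simp]: "\<zero>\<^bsub>free_alg n\<^esub> = 0"
  and add_free_alg [simp]: "p \<oplus>\<^bsub>free_alg n\<^esub> q = p + q"
  by (simp_all add: free_alg_def)

lemma single_in_free_alg:
  "set xs \<subseteq> {1..<n} \<Longrightarrow> Poly_Mapping.single (FMon xs) c \<in> carrier (free_alg n)"
  by (simp add: carrier_free_alg)

lemma free_scal_in_free_alg [simp]: "free_scal c \<in> carrier (free_alg n)"
  by (simp add: carrier_free_alg zero_fmon_def)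

lemma free_alg_add_closed:
  "p \<in> carrier (free_alg n) \<Longrightarrow> q \<in> carrier (free_alg n) \<Longrightarrow> p + q \<in> carrier (free_alg n)"
  unfolding carrier_free_alg using Poly_Mapping.keys_add[of p q] by blast

lemma free_alg_diff_closed:
  fixes p q :: "nat fmon \<Rightarrow>\<^sub>0 'r::comm_ring_1"
  assumes "p \<in> carrier (free_alg n)" "q \<in> carrier (free_alg n)"
  shows "p - q \<in> carrier (free_alg n)"
proof -
  have "Poly_Mapping.keys (p - q) \<subseteq> Poly_Mapping.keys p \<union> Poly_Mapping.keys q"
    by (auto simp: in_keys_iff lookup_minus)
  then show ?thesis using assms unfolding carrier_free_alg by blast
qed

lemma free_alg_mult_closed:
  assumes "p \<in> carrier (free_alg n)" "q \<in> carrier (free_alg n)"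
  shows "p * q \<in> carrier (free_alg n)"
proof -
  have "set (letters m) \<subseteq> {1..<n}" if m: "m \<in> Poly_Mapping.keys (p * q)" for m
  proof -
    from keys_mult[of p q] m obtain a b
      where "m = a + b" "a \<in> Poly_Mapping.keys p" "b \<in> Poly_Mapping.keys q" by blast
    then show ?thesis using assms by (simp add: carrier_free_alg plus_fmon_def)
  qed
  then show ?thesis by (simp add: carrier_free_alg)
qed

lemma ring_free_alg: "ring (free_alg n :: (nat fmon \<Rightarrow>\<^sub>0 'r::comm_ring_1) ring)"
proof (rule ringI)
  show "abelian_group (free_alg n :: (nat fmon \<Rightarrow>\<^sub>0 'r) ring)"
  proof (rule abelian_groupI)
    fix p :: "nat fmon \<Rightarrow>\<^sub>0 'r"
    assume p: "p \<in> carrier (free_alg n)"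
    \<comment> \<open>Closure under negation is read off from closure under differences.\<close>
    have "0 - p \<in> carrier (free_alg n)"
      by (rule free_alg_diff_closed[OF _ p]) (simp add: carrier_free_alg)
    then show "\<exists>q \<in> carrier (free_alg n). q \<oplus>\<^bsub>free_alg n\<^esub> p = \<zero>\<^bsub>free_alg n\<^esub>"
      by (intro bexI[of _ "- p"]) simp_all
  qed (simp_all add: free_alg_add_closed algebra_simps, simp add: carrier_free_alg)
  show "monoid (free_alg n :: (nat fmon \<Rightarrow>\<^sub>0 'r) ring)"
    by (rule monoidI)
      (simp_all add: free_alg_mult_closed algebra_simps, simp add: carrier_free_alg zero_fmon_def)
qed (simp_all add: algebra_simps)

lemma id_relations_in_free_alg: "id_relations \<beta> n \<subseteq> carrier (free_alg n)"
  unfolding id_relations_def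
  by (auto intro!: free_alg_diff_closed free_alg_mult_closed single_in_free_alg)

lemma ideal_id_ideal: "ideal (id_ideal \<beta> n) (free_alg n)"
  unfolding id_ideal_def
  by (rule ring.genideal_ideal[OF ring_free_alg id_relations_in_free_alg])

lemma id_relation_in_id_ideal: "p \<in> id_relations \<beta> n \<Longrightarrow> p \<in> id_ideal \<beta> n"
  unfolding id_ideal_def using ring.genideal_self[OF ring_free_alg id_relations_in_free_alg] by blast

section \<open>The quotient ring and its generators\<close>

locale id_coxeter_algebra =
  fixes \<beta> :: "'r::comm_ring_1" and n :: nat
begin

abbreviation "F \<equiv> free_alg n :: (nat fmon \<Rightarrow>\<^sub>0 'r) ring"
abbreviation "R \<equiv> id_alg \<beta> n"
abbreviation "T \<equiv> to_alg \<beta> n"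

sublocale F: ring F
  by (rule ring_free_alg)

sublocale I: ideal "id_ideal \<beta> n" F
  by (rule ideal_id_ideal)

sublocale ring R
  unfolding id_alg_def by (rule I.quotient_is_ring)

lemma to_alg_ring_hom: "T \<in> ring_hom F R"
proof -
  have "T = (+>\<^bsub>F\<^esub>) (id_ideal \<beta> n)"
    by (rule ext) (simp add: to_alg_def)
  then show ?thesis
    unfolding id_alg_def using I.rcos_ring_hom by simp
qed

lemma to_alg_closed [simp]: "p \<in> carrier F \<Longrightarrow> T p \<in> carrier R"
  using to_alg_ring_hom by (rule ring_hom_closed)

lemma to_alg_mult: "p \<in> carrier F \<Longrightarrow> q \<in> carrier F \<Longrightarrow> T (p * q) = T p \<otimes>\<^bsub>R\<^esub> T q"
  using ring_hom_mult[OF to_alg_ring_hom] by simp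

lemma to_alg_add: "p \<in> carrier F \<Longrightarrow> q \<in> carrier F \<Longrightarrow> T (p + q) = T p \<oplus>\<^bsub>R\<^esub> T q"
  using ring_hom_add[OF to_alg_ring_hom] by simp

lemma to_alg_one: "T 1 = \<one>\<^bsub>R\<^esub>"
  using ring_hom_one[OF to_alg_ring_hom] by simp

lemma zero_id_alg: "\<zero>\<^bsub>R\<^esub> = id_ideal \<beta> n"
  by (simp add: id_alg_def FactRing_def)

lemma to_alg_eq_zero_iff:
  assumes "p \<in> carrier F"
  shows "T p = \<zero>\<^bsub>R\<^esub> \<longleftrightarrow> p \<in> id_ideal \<beta> n"
  unfolding zero_id_alg to_alg_def
  using assms I.rcos_const_imp_mem I.a_rcos_const by blast

text \<open>This turns every relation in the quotient into a computation in the free algebra: the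
  difference of the two sides has to be a combination of defining relations.\<close>

lemma to_alg_eq_iff:
  assumes p: "p \<in> carrier F" and q: "q \<in> carrier F"
  shows "T p = T q \<longleftrightarrow> p - q \<in> id_ideal \<beta> n"
proof -
  have pq: "p - q \<in> carrier F" by (rule free_alg_diff_closed[OF p q])
  then have "T p = T (p - q) \<oplus>\<^bsub>R\<^esub> T q"
    using to_alg_add[OF pq q] by simp
  then show ?thesis
    unfolding to_alg_eq_zero_iff[OF pq, symmetric]
    using pq q by (metis add.r_cancel_one' to_alg_closed)
qed

lemma to_alg_0: "T 0 = \<zero>\<^bsub>R\<^esub>"
  using ring_hom_zero[OF to_alg_ring_hom F.ring_axioms ring_axioms] by simp

lemma sum_in_free_alg: "(\<And>x. x \<in> A \<Longrightarrow> f x \<in> carrier F) \<Longrightarrow> sum f A \<in> carrier F"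
  by (induction A rule: infinite_finite_induct)
    (simp_all add: free_alg_add_closed, simp_all add: carrier_free_alg)

lemma to_alg_sum:
  "finite A \<Longrightarrow> (\<And>x. x \<in> A \<Longrightarrow> f x \<in> carrier F) \<Longrightarrow>
    T (sum f A) = (\<Oplus>\<^bsub>R\<^esub>x \<in> A. T (f x))"
proof (induction A rule: finite_induct)
  case (insert x A)
  then show ?case
    by (simp add: to_alg_add sum_in_free_alg Pi_iff)
qed (simp add: to_alg_0)

lemma scal_closed [simp]: "scal \<beta> n c \<in> carrier R"
  by (simp add: scal_def)

lemma free_word_in [simp]: "set xs \<subseteq> {1..<n} \<Longrightarrow> free_word xs \<in> carrier F"
  by (rule single_in_free_alg)

lemma gen_closed [simp]: "i \<in> {1..<n} \<Longrightarrow> gen \<beta> n i \<in> carrier R"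
  by (simp add: gen_def)

lemma gens_closed: "set xs \<subseteq> {1..<n} \<Longrightarrow> set (map (gen \<beta> n) xs) \<subseteq> carrier R"
  using gen_closed by (auto simp del: atLeastLessThan_iff)

lemma prod_gen_closed [simp]:
  "set xs \<subseteq> {1..<n} \<Longrightarrow> ring_prod_list R (map (gen \<beta> n) xs) \<in> carrier R"
  using gens_closed by blast

lemma prod_gen_eq:
  "set xs \<subseteq> {1..<n} \<Longrightarrow> ring_prod_list R (map (gen \<beta> n) xs) = T (free_word xs)"
proof (induction xs)
  case Nil
  show ?case using to_alg_one by (simp add: zero_fmon_def[symmetric])
next
  case (Cons i xs)
  then have "T (free_word (i # xs)) = T (free_gen i * free_word xs)"
    by (simp add: mult_single)
  also have "\<dots> = gen \<beta> n i \<otimes>\<^bsub>R\<^esub> T (free_word xs)"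
    using Cons.prems by (simp add: to_alg_mult gen_def)
  finally show ?case using Cons by simp
qed

lemma gen_square:
  assumes "i \<in> {1..<n}"
  shows "gen \<beta> n i \<otimes>\<^bsub>R\<^esub> gen \<beta> n i = scal \<beta> n \<beta> \<otimes>\<^bsub>R\<^esub> gen \<beta> n i"
proof -
  have "free_gen i * free_gen i - free_scal \<beta> * free_gen i \<in> id_ideal \<beta> n"
    by (rule id_relation_in_id_ideal) (use assms in \<open>auto simp: id_relations_def\<close>)
  then show ?thesis
    using assms unfolding gen_def scal_def
    by (subst (1 2) to_alg_mult[symmetric]) (simp_all add: to_alg_eq_iff free_alg_mult_closed)
qed

lemma gen_commute:
  assumes "i \<in> {1..<n}" "j \<in> {1..<n}" "\<bar>int i - int j\<bar> > 1"
  shows "gen \<beta> n i \<otimes>\<^bsub>R\<^esub> gen \<beta> n j = gen \<beta> n j \<otimes>\<^bsub>R\<^esub> gen \<beta> n i"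
proof -
  have "free_gen i * free_gen j - free_gen j * free_gen i \<in> id_ideal \<beta> n"
    by (rule id_relation_in_id_ideal) (use assms in \<open>unfold id_relations_def, blast\<close>)
  then show ?thesis
    using assms unfolding gen_def
    by (subst (1 2) to_alg_mult[symmetric]) (simp_all add: to_alg_eq_iff free_alg_mult_closed)
qed

lemma gen_braid:
  assumes "i \<in> {1..<n}" "Suc i \<in> {1..<n}"
  shows "gen \<beta> n i \<otimes>\<^bsub>R\<^esub> gen \<beta> n (Suc i) \<otimes>\<^bsub>R\<^esub> gen \<beta> n i
    = gen \<beta> n (Suc i) \<otimes>\<^bsub>R\<^esub> gen \<beta> n i \<otimes>\<^bsub>R\<^esub> gen \<beta> n (Suc i)"
proof -
  have "free_gen i * free_gen (i + 1) * free_gen i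
      - free_gen (i + 1) * free_gen i * free_gen (i + 1) \<in> id_ideal \<beta> n"
    by (rule id_relation_in_id_ideal) (use assms in \<open>auto simp: id_relations_def\<close>)
  then have "T (free_gen i * free_gen (Suc i) * free_gen i)
      = T (free_gen (Suc i) * free_gen i * free_gen (Suc i))"
    using assms by (subst to_alg_eq_iff) (simp_all add: free_alg_mult_closed)
  then show ?thesis
    using assms unfolding gen_def
    by (simp add: to_alg_mult free_alg_mult_closed)
qed

lemma prod_gen_snoc:
  "set (xs @ [i]) \<subseteq> {1..<n} \<Longrightarrow>
    ring_prod_list R (map (gen \<beta> n) (xs @ [i]))
      = ring_prod_list R (map (gen \<beta> n) xs) \<otimes>\<^bsub>R\<^esub> gen \<beta> n i"
  unfolding map_append using gens_closed[of xs] by (subst ring_prod_list_append) auto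

end

section \<open>The basis of the quotient algebra\<close>

text \<open>The value at \<open>v\<close> is the coefficient of \<open>u_v\<close> after multiplying
  the sum of the \<open>f w\<close> times \<open>u_w\<close> by \<open>u_i\<close> on the right. A
  product lands on \<open>u_v\<close> only from v s_i, where i is an ascent, or from
  \<open>v\<close> itself with factor \<beta>; both need a descent of \<open>v\<close> at i.\<close>

definition hecke_act :: "'r::comm_ring_1 \<Rightarrow> nat \<Rightarrow> ((nat \<Rightarrow> nat) \<Rightarrow> 'r) \<Rightarrow> (nat \<Rightarrow> nat) \<Rightarrow> 'r" where
  "hecke_act \<beta> i f = (\<lambda>v. if v (Suc i) < v i then f (v \<circ> simple_refl i) + \<beta> * f v else 0)"

text \<open>With \<open>fold\<close> the first letter acts first, as a right action
  requires.\<close>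

definition word_act :: "'r::comm_ring_1 \<Rightarrow> nat list \<Rightarrow> ((nat \<Rightarrow> nat) \<Rightarrow> 'r) \<Rightarrow> (nat \<Rightarrow> nat) \<Rightarrow> 'r" where
  "word_act \<beta> = fold (hecke_act \<beta>)"

definition free_act ::
  "'r::comm_ring_1 \<Rightarrow> (nat fmon \<Rightarrow>\<^sub>0 'r) \<Rightarrow> ((nat \<Rightarrow> nat) \<Rightarrow> 'r) \<Rightarrow> (nat \<Rightarrow> nat) \<Rightarrow> 'r" where
  "free_act \<beta> p f v = (\<Sum>m \<in> Poly_Mapping.keys p. Poly_Mapping.lookup p m * word_act \<beta> (letters m) f v)"

text \<open>If \<open>v\<close> has a descent at i then v s_i has none, so the inner action vanishes
  there and only the \<beta>-term is left.\<close>

lemma hecke_act_square: "hecke_act \<beta> i (hecke_act \<beta> i f) = (\<lambda>v. \<beta> * hecke_act \<beta> i f v)"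
  by (auto simp: hecke_act_def fun_eq_iff)

lemma hecke_act_commute:
  assumes "\<bar>int i - int j\<bar> > 1"
  shows "hecke_act \<beta> i (hecke_act \<beta> j f) = hecke_act \<beta> j (hecke_act \<beta> i f)"
proof
  fix v :: "nat \<Rightarrow> nat"
  have "v \<circ> simple_refl i \<circ> simple_refl j = v \<circ> simple_refl j \<circ> simple_refl i"
    by (simp only: comp_assoc simple_refl_commute[OF assms])
  moreover have "simple_refl i j = j" "simple_refl i (Suc j) = Suc j"
    "simple_refl j i = i" "simple_refl j (Suc i) = Suc i"
    using assms by (auto simp: simple_refl_def transpose_def)
  ultimately show "hecke_act \<beta> i (hecke_act \<beta> j f) v = hecke_act \<beta> j (hecke_act \<beta> i f) v"
    by (auto simp: hecke_act_def algebra_simps)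
qed

lemma hecke_act_braid:
  "hecke_act \<beta> i (hecke_act \<beta> (Suc i) (hecke_act \<beta> i f))
    = hecke_act \<beta> (Suc i) (hecke_act \<beta> i (hecke_act \<beta> (Suc i) f))"
proof
  fix v :: "nat \<Rightarrow> nat"
  have b: "v \<circ> simple_refl i \<circ> simple_refl (Suc i) \<circ> simple_refl i
      = v \<circ> simple_refl (Suc i) \<circ> simple_refl i \<circ> simple_refl (Suc i)"
    using simple_refl_braid[of i] by (simp only: comp_assoc)
  have [simp]: "simple_refl i (Suc (Suc i)) = Suc (Suc i)" "simple_refl (Suc i) i = i"
    by simp_all
  show "hecke_act \<beta> i (hecke_act \<beta> (Suc i) (hecke_act \<beta> i f)) v
      = hecke_act \<beta> (Suc i) (hecke_act \<beta> i (hecke_act \<beta> (Suc i) f)) v"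
    \<comment> \<open>Both sides depend only on the relative order of three consecutive entries.
      Ties are included because \<open>v\<close> is an arbitrary function, not assumed
      injective.\<close>
    using b by (cases "v i" "v (Suc i)" rule: linorder_cases;
      cases "v i" "v (Suc (Suc i))" rule: linorder_cases;
      cases "v (Suc i)" "v (Suc (Suc i))" rule: linorder_cases)
      (simp_all add: hecke_act_def algebra_simps)
qed

lemma hecke_act_add: "hecke_act \<beta> i (\<lambda>v. f v + g v) = (\<lambda>v. hecke_act \<beta> i f v + hecke_act \<beta> i g v)"
  by (auto simp: hecke_act_def fun_eq_iff algebra_simps)

lemma hecke_act_scale: "hecke_act \<beta> i (\<lambda>v. c * f v) = (\<lambda>v. c * hecke_act \<beta> i f v)"
  by (auto simp: hecke_act_def fun_eq_iff algebra_simps)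

lemma word_act_simps [simp]:
  "word_act \<beta> [] f = f"
  "word_act \<beta> (i # xs) f = word_act \<beta> xs (hecke_act \<beta> i f)"
  "word_act \<beta> (xs @ ys) f = word_act \<beta> ys (word_act \<beta> xs f)"
  by (simp_all add: word_act_def)

lemma word_act_add: "word_act \<beta> xs (\<lambda>v. f v + g v) = (\<lambda>v. word_act \<beta> xs f v + word_act \<beta> xs g v)"
  by (induction xs arbitrary: f g) (simp_all add: hecke_act_add)

lemma word_act_scale: "word_act \<beta> xs (\<lambda>v. c * f v) = (\<lambda>v. c * word_act \<beta> xs f v)"
  by (induction xs arbitrary: f) (simp_all add: hecke_act_scale)

text \<open>Summing over a common finite superset of the supports avoids tracking cancellations when
  two elements are added.\<close>

lemma free_act_superset:
  assumes "finite A" "Poly_Mapping.keys p \<subseteq> A"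
  shows "free_act \<beta> p f v = (\<Sum>m \<in> A. Poly_Mapping.lookup p m * word_act \<beta> (letters m) f v)"
  unfolding free_act_def
  by (rule sum.mono_neutral_left) (use assms in \<open>auto simp: in_keys_iff\<close>)

lemma free_act_add: "free_act \<beta> (p + q) f v = free_act \<beta> p f v + free_act \<beta> q f v"
proof -
  let ?A = "Poly_Mapping.keys p \<union> Poly_Mapping.keys q"
  have "finite ?A" "Poly_Mapping.keys (p + q) \<subseteq> ?A"
    by (simp_all add: Poly_Mapping.keys_add)
  then show ?thesis
    by (simp add: free_act_superset[of ?A] lookup_add distrib_right sum.distrib)
qed

lemma free_act_diff: "free_act \<beta> (p - q) f v = free_act \<beta> p f v - free_act \<beta> q f v"
  using free_act_add[of \<beta> "p - q" q f v] by simp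

lemma free_act_zero [simp]: "free_act \<beta> 0 f v = 0"
  by (simp add: free_act_def)

lemma free_act_sum: "free_act \<beta> (sum g A) f v = (\<Sum>x \<in> A. free_act \<beta> (g x) f v)"
  by (induction A rule: infinite_finite_induct) (simp_all add: free_act_add)

lemma free_act_single [simp]:
  "free_act \<beta> (Poly_Mapping.single m c) f v = c * word_act \<beta> (letters m) f v"
  by (subst free_act_superset[of "{m}"]) simp_all

lemma free_act_fun_add:
  "free_act \<beta> p (\<lambda>v. f v + g v) v = free_act \<beta> p f v + free_act \<beta> p g v"
  by (simp add: free_act_def word_act_add distrib_left sum.distrib)

lemma free_act_fun_zero [simp]: "free_act \<beta> p (\<lambda>v. 0) v = 0"
  using free_act_fun_add[of \<beta> p "\<lambda>v. 0" "\<lambda>v. 0" v] by simp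

text \<open>The factor \<open>p\<close> acts first since words are concatenated in the order in
  which their letters act. Linearity in both factors reduces the claim to monomials.\<close>

lemma free_act_mult: "free_act \<beta> (p * q) f v = free_act \<beta> q (free_act \<beta> p f) v"
proof (induction q rule: poly_mapping_single_sum_induct)
  case (single k c)
  show ?case
  proof (induction p arbitrary: v rule: poly_mapping_single_sum_induct)
    case (single l d)
    have "free_act \<beta> (Poly_Mapping.single l d) f = (\<lambda>v. d * word_act \<beta> (letters l) f v)"
      by (rule ext) simp
    then show ?case by (simp add: mult_single plus_fmon_def word_act_scale)
  next
    case (sum p q)
    have "free_act \<beta> (p + q) f = (\<lambda>v. free_act \<beta> p f v + free_act \<beta> q f v)"
      by (rule ext) (rule free_act_add)
    then show ?case
      using sum by (simp add: distrib_right free_act_add word_act_add distrib_left)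
  qed
next
  case (sum p q)
  then show ?case by (simp add: distrib_left free_act_add)
qed

text \<open>Asking for annihilation of every \<open>f\<close> makes the kernel two-sided:
  \<open>q * p\<close> lets \<open>p\<close> act on another function, and \<open>p * q\<close> lets
  \<open>q\<close> act on the zero function.\<close>

lemma ideal_free_act_kernel:
  fixes \<beta> :: "'a::comm_ring_1"
  shows "ideal {p \<in> carrier (free_alg n). \<forall>f v. free_act \<beta> p f v = 0} (free_alg n)"
proof (rule idealI)
  let ?K = "{p \<in> carrier (free_alg n). \<forall>f v. free_act \<beta> p f v = 0}"
  interpret F: ring "free_alg n :: (nat fmon \<Rightarrow>\<^sub>0 'a) ring"
    by (rule ring_free_alg)
  show "ring (free_alg n :: (nat fmon \<Rightarrow>\<^sub>0 'a) ring)"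
    by (rule ring_free_alg)
  show "subgroup ?K (add_monoid (free_alg n))"
  proof (rule group.subgroupI[OF F.a_group])
    show "?K \<noteq> {}"
      using F.zero_closed by (auto intro!: exI[of _ 0])
    show "inv\<^bsub>add_monoid (free_alg n)\<^esub> p \<in> ?K" if "p \<in> ?K" for p
    proof -
      have c: "\<ominus>\<^bsub>free_alg n\<^esub> p \<in> carrier (free_alg n)"
        using that by (simp add: F.a_inv_closed)
      have "\<ominus>\<^bsub>free_alg n\<^esub> p + p = 0"
        using F.l_neg[of p] that by simp
      then have "free_act \<beta> (\<ominus>\<^bsub>free_alg n\<^esub> p) f v + free_act \<beta> p f v = 0" for f v
        by (simp flip: free_act_add)
      with c that show ?thesis by (simp add: a_inv_def)
    qed
  qed (auto simp: free_act_add free_alg_add_closed)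
  fix p q :: "nat fmon \<Rightarrow>\<^sub>0 'a"
  assume p: "p \<in> ?K" and q: "q \<in> carrier (free_alg n)"
  have "free_act \<beta> p f = (\<lambda>v. 0)" for f
    using p by auto
  with p q show "q \<otimes>\<^bsub>free_alg n\<^esub> p \<in> ?K" "p \<otimes>\<^bsub>free_alg n\<^esub> q \<in> ?K"
    by (simp_all add: free_alg_mult_closed free_act_mult)
qed

text \<open>The action respects the defining relations, so the kernel is an ideal containing them
  and hence contains the ideal they generate. In this way the action descends to the
  quotient.\<close>

lemma free_act_id_ideal:
  assumes "p \<in> id_ideal \<beta> n"
  shows "free_act \<beta> p f v = 0"
proof -
  have "id_relations \<beta> n \<subseteq> {p \<in> carrier (free_alg n). \<forall>f v. free_act \<beta> p f v = 0}"
  proof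
    fix p assume p: "p \<in> id_relations \<beta> n"
    have "free_act \<beta> p f v = 0" for f v
      using p unfolding id_relations_def
      by (auto simp: mult_single free_act_diff zero_fmon_def hecke_act_square
        hecke_act_braid hecke_act_commute)
    with p id_relations_in_free_alg[of \<beta> n]
    show "p \<in> {p \<in> carrier (free_alg n). \<forall>f v. free_act \<beta> p f v = 0}" by blast
  qed
  from ring.genideal_minimal[OF ring_free_alg ideal_free_act_kernel this] assms
  show ?thesis unfolding id_ideal_def by blast
qed

text \<open>Along a reduced word every letter meets an ascent, so the indicator of the identity is
  only moved and no \<beta>-term appears.\<close>

lemma word_act_reduced_word:
  fixes \<beta> :: "'r::comm_ring_1"
  assumes "reduced_word n w xs"
  shows "word_act \<beta> xs (\<lambda>v. of_bool (v = id)) = (\<lambda>v. of_bool (v = w))"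
  using assms
proof (induction xs arbitrary: w rule: rev_induct)
  case Nil
  then show ?case by (auto simp: reduced_word_def)
next
  case (snoc i xs)
  from reduced_word_snoc[OF reduced_word_permutes[OF snoc.prems]] snoc.prems
  have desc: "w (Suc i) < w i" and red: "reduced_word n (w \<circ> simple_refl i) xs" by auto
  have "hecke_act \<beta> i (\<lambda>v. of_bool (v = w \<circ> simple_refl i)) = (\<lambda>v. of_bool (v = w))"
  proof
    fix v
    show "hecke_act \<beta> i (\<lambda>v. of_bool (v = w \<circ> simple_refl i)) v = of_bool (v = w)"
    proof (cases "v (Suc i) < v i")
      case True
      then have "v \<noteq> w \<circ> simple_refl i" using desc by auto
      moreover have "v \<circ> simple_refl i = w \<circ> simple_refl i \<longleftrightarrow> v = w"
        by (metis comp_simple_refl_self)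
      ultimately show ?thesis using True by (simp add: hecke_act_def)
    next
      case False
      with desc show ?thesis by (auto simp: hecke_act_def)
    qed
  qed
  then show ?case
    by (simp only: word_act_simps snoc.IH[OF red])
qed

section \<open>Matsumoto's theorem and multiplication of the elements \<open>u_w\<close> by
  generators\<close>

context id_coxeter_algebra
begin

abbreviation word_elt :: "nat list \<Rightarrow> (nat fmon \<Rightarrow>\<^sub>0 'r) set" where
  "word_elt xs \<equiv> ring_prod_list R (map (gen \<beta> n) xs)"

lemma word_elt_snoc:
  "reduced_word n v (zs @ [i]) \<Longrightarrow> word_elt (zs @ [i]) = word_elt zs \<otimes>\<^bsub>R\<^esub> gen \<beta> n i"
  by (intro prod_gen_snoc) (simp add: reduced_word_def)

lemma word_elt_closed: "reduced_word n v zs \<Longrightarrow> word_elt zs \<in> carrier R"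
  by (intro prod_gen_closed) (simp add: reduced_word_def)

lemma reduced_word_snocI:
  "v permutes {1..n} \<Longrightarrow> reduced_word n (v \<circ> simple_refl i) zs \<Longrightarrow> i \<in> {1..<n} \<Longrightarrow>
    v (Suc i) < v i \<Longrightarrow> reduced_word n v (zs @ [i])"
  by (simp add: reduced_word_snoc)

text \<open>The induction step of Matsumoto's theorem: two reduced words ending in different letters \<open>i\<close>
  and \<open>j\<close> are compared through words ending in the longest element of the subgroup generated by
  \<open>s\<^sub>i\<close> and \<open>s\<^sub>j\<close>.\<close>

lemma reduced_words_join:
  assumes w: "w permutes {1..n}" and "i \<noteq> j"
    and i: "i \<in> {1..<n}" "w (Suc i) < w i" and j: "j \<in> {1..<n}" "w (Suc j) < w j"
  shows "\<exists>us vs. reduced_word n (w \<circ> simple_refl i) us \<and> reduced_word n (w \<circ> simple_refl j) vs \<and>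
    word_elt us \<otimes>\<^bsub>R\<^esub> gen \<beta> n i = word_elt vs \<otimes>\<^bsub>R\<^esub> gen \<beta> n j"
proof -
  let ?m = "(\<otimes>\<^bsub>R\<^esub>)"
  \<comment> \<open>The adjacent case is proved for a fresh i and its successor, so that by symmetry
    it serves both j = i+1 and i = j+1.\<close>
  have adj: "\<exists>us vs. reduced_word n (w \<circ> simple_refl i) us \<and>
      reduced_word n (w \<circ> simple_refl (Suc i)) vs \<and>
      ?m (word_elt us) (gen \<beta> n i) = ?m (word_elt vs) (gen \<beta> n (Suc i))"
    if i: "i \<in> {1..<n}" "w (Suc i) < w i" and j: "Suc i \<in> {1..<n}" "w (Suc (Suc i)) < w (Suc i)" for i
  proof -
    let ?s = "simple_refl i" and ?t = "simple_refl (Suc i)"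
    have [simp]: "?t i = i" "?s (Suc (Suc i)) = Suc (Suc i)" by simp_all
    have p: "w \<circ> ?s permutes {1..n}" "w \<circ> ?s \<circ> ?t permutes {1..n}"
      "w \<circ> ?t permutes {1..n}" "w \<circ> ?t \<circ> ?s permutes {1..n}"
      "w \<circ> ?s \<circ> ?t \<circ> ?s permutes {1..n}"
      by (intro permutes_comp_simple_refl w i(1) j(1))+
    \<comment> \<open>Three consecutive entries of \<open>w\<close> are decreasing, so the longest
      element of the subgroup splits off on the right. Appending two of its letters to
      \<open>zs\<close> in either order gives the two words wanted.\<close>
    obtain zs where zs: "reduced_word n (w \<circ> ?s \<circ> ?t \<circ> ?s) zs"
      using ex_reduced_word[OF p(5)] by blast
    have b: "w \<circ> ?s \<circ> ?t \<circ> ?s = w \<circ> ?t \<circ> ?s \<circ> ?t"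
      using simple_refl_braid[of i] by (simp only: comp_assoc)
    have u1: "reduced_word n (w \<circ> ?s \<circ> ?t) (zs @ [i])"
      by (rule reduced_word_snocI[OF p(2) zs i(1)]) (use j(2) in simp)
    have u2: "reduced_word n (w \<circ> ?s) ((zs @ [i]) @ [Suc i])"
      by (rule reduced_word_snocI[OF p(1) u1 j(1)]) (use i j in simp)
    have v1: "reduced_word n (w \<circ> ?t \<circ> ?s) (zs @ [Suc i])"
      by (rule reduced_word_snocI[OF p(4) zs[unfolded b] j(1)]) (use i(2) in simp)
    have v2: "reduced_word n (w \<circ> ?t) ((zs @ [Suc i]) @ [i])"
      by (rule reduced_word_snocI[OF p(3) v1 i(1)]) (use i j in simp)
    note c = word_elt_closed[OF zs] gen_closed[OF i(1)] gen_closed[OF j(1)]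
    have "?m (word_elt ((zs @ [i]) @ [Suc i])) (gen \<beta> n i)
        = ?m (word_elt zs) (?m (?m (gen \<beta> n i) (gen \<beta> n (Suc i))) (gen \<beta> n i))"
      using c by (simp only: word_elt_snoc[OF u2] word_elt_snoc[OF u1] m_assoc m_closed)
    also have "\<dots> = ?m (word_elt zs) (?m (?m (gen \<beta> n (Suc i)) (gen \<beta> n i)) (gen \<beta> n (Suc i)))"
      by (simp only: gen_braid[OF i(1) j(1)])
    also have "\<dots> = ?m (word_elt ((zs @ [Suc i]) @ [i])) (gen \<beta> n (Suc i))"
      using c by (simp only: word_elt_snoc[OF v2] word_elt_snoc[OF v1] m_assoc m_closed)
    finally show ?thesis using u2 v2 by blast
  qed
  consider "j = Suc i" | "i = Suc j" | "\<bar>int i - int j\<bar> > 1"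
    using \<open>i \<noteq> j\<close> by linarith
  then show ?thesis
  proof cases
    case 1
    then show ?thesis using adj[OF i] j by simp
  next
    case 2
    then show ?thesis using adj[OF j] i by metis
  next
    case 3
    let ?s = "simple_refl i" and ?t = "simple_refl j"
    have [simp]: "?s j = j" "?s (Suc j) = Suc j" "?t i = i" "?t (Suc i) = Suc i"
      using 3 by (auto simp: simple_refl_def transpose_def)
    have p: "w \<circ> ?s permutes {1..n}" "w \<circ> ?s \<circ> ?t permutes {1..n}" "w \<circ> ?t permutes {1..n}"
      by (intro permutes_comp_simple_refl w i(1) j(1))+
    obtain zs where zs: "reduced_word n (w \<circ> ?s \<circ> ?t) zs"
      using ex_reduced_word[OF p(2)] by blast
    have b: "w \<circ> ?s \<circ> ?t = w \<circ> ?t \<circ> ?s"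
      by (simp only: comp_assoc simple_refl_commute[OF 3])
    have u: "reduced_word n (w \<circ> ?s) (zs @ [j])"
      by (rule reduced_word_snocI[OF p(1) zs j(1)]) (use j in simp)
    have v: "reduced_word n (w \<circ> ?t) (zs @ [i])"
      by (rule reduced_word_snocI[OF p(3) zs[unfolded b] i(1)]) (use i in simp)
    note c = word_elt_closed[OF zs] gen_closed[OF i(1)] gen_closed[OF j(1)]
    have "?m (word_elt (zs @ [j])) (gen \<beta> n i) = ?m (word_elt zs) (?m (gen \<beta> n j) (gen \<beta> n i))"
      using c by (simp only: word_elt_snoc[OF u] m_assoc)
    also have "\<dots> = ?m (word_elt zs) (?m (gen \<beta> n i) (gen \<beta> n j))"
      by (simp only: gen_commute[OF i(1) j(1) 3])
    also have "\<dots> = ?m (word_elt (zs @ [i])) (gen \<beta> n j)"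
      using c by (simp only: word_elt_snoc[OF v] m_assoc)
    finally show ?thesis using u v by blast
  qed
qed

text \<open>Words with the same last letter are compared by induction on the length. For different
  last letters the two words of \<open>reduced_words_join\<close> stand in between, and induction
  applies to each shortened word separately.\<close>

lemma word_elt_reduced_word_unique:
  assumes "reduced_word n w xs" "reduced_word n w ys"
  shows "word_elt xs = word_elt ys"
  using assms
proof (induction "length xs" arbitrary: w xs ys rule: less_induct)
  case less
  note w = reduced_word_permutes[OF less.prems(1)]
  have len: "length xs = length ys"
    using less.prems by (simp add: reduced_word_def)
  show ?case
  proof (cases xs rule: rev_cases)
    case Nil
    with len show ?thesis by simp
  next
    case xs: (snoc xs' i)
    with len obtain ys' j where ys: "ys = ys' @ [j]" by (cases ys rule: rev_cases) auto
    have i: "i \<in> {1..<n}" "w (Suc i) < w i" "reduced_word n (w \<circ> simple_refl i) xs'"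
      using less.prems(1) reduced_word_snoc[OF w] xs by auto
    have j: "j \<in> {1..<n}" "w (Suc j) < w j" "reduced_word n (w \<circ> simple_refl j) ys'"
      using less.prems(2) reduced_word_snoc[OF w] ys by auto
    have eqs: "word_elt xs = word_elt xs' \<otimes>\<^bsub>R\<^esub> gen \<beta> n i"
      "word_elt ys = word_elt ys' \<otimes>\<^bsub>R\<^esub> gen \<beta> n j"
      using less.prems word_elt_snoc xs ys by blast+
    have IH: "word_elt xs' = word_elt us" if "reduced_word n (w \<circ> simple_refl i) us" for us
      using less.hyps[OF _ i(3) that] xs by simp
    have IH': "word_elt ys' = word_elt vs" if "reduced_word n (w \<circ> simple_refl j) vs" for vs
      using less.hyps[OF _ j(3) that] ys len by simp
    show ?thesis
    proof (cases "i = j")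
      case True
      then show ?thesis using IH j(3) unfolding eqs by simp
    next
      case False
      from reduced_words_join[OF w False i(1,2) j(1,2)] show ?thesis
        unfolding eqs using IH IH' by metis
    qed
  qed
qed

lemma basis_elt_eq:
  assumes "reduced_word n w xs"
  shows "basis_elt \<beta> n w = word_elt xs"
  unfolding basis_elt_def
  by (rule word_elt_reduced_word_unique[OF someI assms]) (rule assms)

lemma basis_elt_closed [simp]: "w permutes {1..n} \<Longrightarrow> basis_elt \<beta> n w \<in> carrier R"
  using ex_reduced_word basis_elt_eq word_elt_closed by metis

lemma basis_elt_id: "basis_elt \<beta> n id = \<one>\<^bsub>R\<^esub>"
  using basis_elt_eq[of id "[]"] by (simp add: reduced_word_def del: id_apply)

lemma basis_elt_simple_refl:
  assumes "i \<in> {1..<n}"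
  shows "basis_elt \<beta> n (simple_refl i) = gen \<beta> n i" and "len n (simple_refl i) = 1"
proof -
  show l: "len n (simple_refl i) = 1"
    using len_ascent[OF permutes_id assms] by simp
  then have "reduced_word n (simple_refl i) [i]"
    using assms by (simp add: reduced_word_def)
  from basis_elt_eq[OF this] show "basis_elt \<beta> n (simple_refl i) = gen \<beta> n i"
    using assms by simp
qed

lemma basis_elt_mult_gen_ascent:
  assumes w: "w permutes {1..n}" and i: "i \<in> {1..<n}" "w i < w (Suc i)"
  shows "basis_elt \<beta> n w \<otimes>\<^bsub>R\<^esub> gen \<beta> n i = basis_elt \<beta> n (w \<circ> simple_refl i)"
proof -
  obtain xs where xs: "reduced_word n w xs" using ex_reduced_word[OF w] by blast
  have red: "reduced_word n (w \<circ> simple_refl i) (xs @ [i])"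
    by (rule reduced_word_snocI[OF permutes_comp_simple_refl[OF w i(1)]]) (use i xs in simp_all)
  show ?thesis
    by (simp only: basis_elt_eq[OF xs] basis_elt_eq[OF red] word_elt_snoc[OF red])
qed

lemma carrier_id_alg: "carrier R = T ` carrier F"
  by (auto simp: id_alg_def FactRing_def A_RCOSETS_def' to_alg_def)

lemma scal_central:
  assumes "x \<in> carrier R"
  shows "x \<otimes>\<^bsub>R\<^esub> scal \<beta> n c = scal \<beta> n c \<otimes>\<^bsub>R\<^esub> x"
proof -
  obtain p where "p \<in> carrier F" "x = T p"
    using assms by (auto simp: carrier_id_alg)
  then show ?thesis
    unfolding scal_def by (simp add: to_alg_mult[symmetric] free_scal_commute)
qed

text \<open>At a descent a factor \<open>u_i\<close> splits off on the right of \<open>u_w\<close>,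
  and the quadratic relation replaces its square by \<beta> times itself.\<close>

lemma basis_elt_mult_gen_descent:
  assumes w: "w permutes {1..n}" and i: "i \<in> {1..<n}" "w (Suc i) < w i"
  shows "basis_elt \<beta> n w \<otimes>\<^bsub>R\<^esub> gen \<beta> n i = scal \<beta> n \<beta> \<otimes>\<^bsub>R\<^esub> basis_elt \<beta> n w"
proof -
  let ?m = "(\<otimes>\<^bsub>R\<^esub>)" and ?v = "w \<circ> simple_refl i"
  note v = permutes_comp_simple_refl[OF w i(1)]
  note c = basis_elt_closed[OF v] gen_closed[OF i(1)] scal_closed[of \<beta>]
  have eq: "basis_elt \<beta> n w = ?m (basis_elt \<beta> n ?v) (gen \<beta> n i)"
    using basis_elt_mult_gen_ascent[OF v i(1)] i(2) by simp
  have "?m (basis_elt \<beta> n w) (gen \<beta> n i) = ?m (basis_elt \<beta> n ?v) (?m (gen \<beta> n i) (gen \<beta> n i))"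
    using c by (simp only: eq m_assoc)
  also have "\<dots> = ?m (?m (basis_elt \<beta> n ?v) (scal \<beta> n \<beta>)) (gen \<beta> n i)"
    using c by (simp only: gen_square[OF i(1)] m_assoc)
  also have "\<dots> = ?m (scal \<beta> n \<beta>) (basis_elt \<beta> n w)"
    using c by (simp only: scal_central eq m_assoc)
  finally show ?thesis .
qed

section \<open>Expansions in the elements \<open>u_w\<close>\<close>

definition repr_word :: "(nat \<Rightarrow> nat) \<Rightarrow> nat fmon \<Rightarrow>\<^sub>0 'r" where
  "repr_word v = free_word (SOME xs. reduced_word n v xs)"

text \<open>The sum is formed in the free algebra and only then mapped to the quotient, so that it
  can be manipulated as an ordinary finite sum. \<open>repr_word\<close> makes the same choice of
  reduced word as \<open>basis_elt\<close>.\<close>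

definition expansion :: "((nat \<Rightarrow> nat) \<Rightarrow> 'r) \<Rightarrow> (nat fmon \<Rightarrow>\<^sub>0 'r) set" where
  "expansion c = T (\<Sum>v | v permutes {1..n}. free_scal (c v) * repr_word v)"

lemma some_reduced_word:
  "v permutes {1..n} \<Longrightarrow> reduced_word n v (SOME xs. reduced_word n v xs)"
  using ex_reduced_word by (blast intro: someI)

lemma repr_word_in [simp]: "v permutes {1..n} \<Longrightarrow> repr_word v \<in> carrier F"
  unfolding repr_word_def by (rule free_word_in[OF reduced_word_letters[OF some_reduced_word]])

lemma to_alg_repr_word: "v permutes {1..n} \<Longrightarrow> T (repr_word v) = basis_elt \<beta> n v"
  unfolding repr_word_def basis_elt_def
  by (rule prod_gen_eq[OF reduced_word_letters[OF some_reduced_word], symmetric])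

lemma scal_mult_basis_elt:
  "v permutes {1..n} \<Longrightarrow>
    scal \<beta> n c \<otimes>\<^bsub>R\<^esub> basis_elt \<beta> n v = T (free_scal c * repr_word v)"
  by (simp add: to_alg_mult scal_def to_alg_repr_word)

lemma finite_permutes: "finite {v. v permutes {1..n}}"
  by (rule finite_permutations) simp

lemma expansion_eq_finsum:
  "expansion c = (\<Oplus>\<^bsub>R\<^esub>v \<in> {v. v permutes {1..n}}.
     scal \<beta> n (c v) \<otimes>\<^bsub>R\<^esub> basis_elt \<beta> n v)"
proof -
  have "expansion c = (\<Oplus>\<^bsub>R\<^esub>v \<in> {v. v permutes {1..n}}. T (free_scal (c v) * repr_word v))"
    unfolding expansion_def by (rule to_alg_sum[OF finite_permutes]) (auto intro: free_alg_mult_closed)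
  also have "\<dots> = (\<Oplus>\<^bsub>R\<^esub>v \<in> {v. v permutes {1..n}}.
     scal \<beta> n (c v) \<otimes>\<^bsub>R\<^esub> basis_elt \<beta> n v)"
    by (rule finsum_cong'[OF refl]) (auto intro!: m_closed basis_elt_closed simp: scal_mult_basis_elt)
  finally show ?thesis .
qed

lemma free_act_repr_word:
  assumes "v permutes {1..n}"
  shows "free_act \<beta> (free_scal c * repr_word v) (\<lambda>u. of_bool (u = id)) u = c * of_bool (u = v)"
  using word_act_reduced_word[OF some_reduced_word[OF assms], of \<beta>]
  by (simp add: repr_word_def mult_single)

text \<open>This is linear independence: the difference of two lifts lies in the ideal and acts by
  zero, while acting on the indicator of the identity recovers each coefficient.\<close>

lemma expansion_unique:
  assumes eq: "expansion c = expansion d" and u: "u permutes {1..n}"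
  shows "c u = d u"
proof -
  let ?S = "{v. v permutes {1..n}}"
  let ?p = "\<lambda>c. \<Sum>v \<in> ?S. free_scal (c v) * repr_word v"
  have "?p c - ?p d \<in> id_ideal \<beta> n"
    using eq unfolding expansion_def
    by (subst (asm) to_alg_eq_iff) (auto intro!: sum_in_free_alg free_alg_mult_closed)
  from free_act_id_ideal[OF this]
  have "free_act \<beta> (?p c) (\<lambda>v. of_bool (v = id)) u = free_act \<beta> (?p d) (\<lambda>v. of_bool (v = id)) u"
    by (simp only: free_act_diff right_minus_eq)
  moreover have "free_act \<beta> (?p c) (\<lambda>v. of_bool (v = id)) u = c u" for c
  proof -
    have "free_act \<beta> (?p c) (\<lambda>v. of_bool (v = id)) u = (\<Sum>v \<in> ?S. if u = v then c v else 0)"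
      unfolding free_act_sum by (rule sum.cong) (simp_all add: free_act_repr_word)
    then show ?thesis using u by (simp add: sum.delta'[OF finite_permutes] del: One_nat_def)
  qed
  ultimately show ?thesis by simp
qed

text \<open>Existence is the given expansion, uniqueness is linear independence on permutations. The
  hypothesis matches the normalisation outside S_n in \<open>alg_coeff\<close>.\<close>

lemma alg_coeff_expansion:
  assumes "\<And>v. \<not> v permutes {1..n} \<Longrightarrow> c v = 0"
  shows "alg_coeff \<beta> n (expansion c) = c"
  unfolding alg_coeff_def expansion_eq_finsum[symmetric]
  using assms expansion_unique by (intro the_equality) (auto simp: fun_eq_iff, metis)

lemma basis_elt_multiple_unique:
  assumes v: "v permutes {1..n}" and w: "w permutes {1..n}" and "c \<noteq> 0"
    and eq: "scal \<beta> n c \<otimes>\<^bsub>R\<^esub> basis_elt \<beta> n v = scal \<beta> n d \<otimes>\<^bsub>R\<^esub> basis_elt \<beta> n w"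
  shows "v = w"
proof (rule ccontr)
  assume "v \<noteq> w"
  have "free_scal c * repr_word v - free_scal d * repr_word w \<in> id_ideal \<beta> n"
    using eq v w unfolding scal_mult_basis_elt[OF v] scal_mult_basis_elt[OF w]
    by (subst (asm) to_alg_eq_iff) (auto intro!: free_alg_mult_closed)
  from free_act_id_ideal[OF this, of "\<lambda>u. of_bool (u = id)" v] \<open>v \<noteq> w\<close> \<open>c \<noteq> 0\<close> show False
    by (simp add: free_act_diff free_act_repr_word[OF v] free_act_repr_word[OF w])
qed

lemma basis_elt_mult_gen:
  assumes w: "w permutes {1..n}" and i: "i \<in> {1..<n}"
  shows "T (repr_word w * free_gen i)
    = T (if w (Suc i) < w i then free_scal \<beta> * repr_word w else repr_word (w \<circ> simple_refl i))"
proof -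
  have "T (repr_word w * free_gen i) = basis_elt \<beta> n w \<otimes>\<^bsub>R\<^esub> gen \<beta> n i"
    using w i by (simp add: to_alg_mult to_alg_repr_word gen_def)
  also have "\<dots> = T (if w (Suc i) < w i then free_scal \<beta> * repr_word w
      else repr_word (w \<circ> simple_refl i))"
  proof (cases "w (Suc i) < w i")
    case True
    then show ?thesis
      using basis_elt_mult_gen_descent[OF w i True] scal_mult_basis_elt[OF w] by simp
  next
    case False
    then have "w i < w (Suc i)" using permutes_neq_Suc[OF w, of i] by simp
    then show ?thesis
      using basis_elt_mult_gen_ascent[OF w i] False
        to_alg_repr_word[OF permutes_comp_simple_refl[OF w i]] by simp
  qed
  finally show ?thesis .
qed

lemma to_alg_sum_cong:
  assumes "finite A" "\<And>x. x \<in> A \<Longrightarrow> f x \<in> carrier F" "\<And>x. x \<in> A \<Longrightarrow> g x \<in> carrier F"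
    and "\<And>x. x \<in> A \<Longrightarrow> T (f x) = T (g x)"
  shows "T (sum f A) = T (sum g A)"
  using assms by (induction A rule: finite_induct) (simp_all add: to_alg_add sum_in_free_alg)

text \<open>The formula for single basis elements extends linearly. Right multiplication by s_i
  matches descents with ascents, so the ascent terms can be collected at the descents they
  produce.\<close>

lemma expansion_mult_gen:
  assumes i: "i \<in> {1..<n}"
  shows "expansion c \<otimes>\<^bsub>R\<^esub> gen \<beta> n i = expansion (hecke_act \<beta> i c)"
proof -
  let ?S = "{v. v permutes {1..n}}" and ?s = "\<lambda>v. v \<circ> simple_refl i"
  let ?D = "{v \<in> ?S. v (Suc i) < v i}" and ?A = "{v \<in> ?S. \<not> v (Suc i) < v i}"
  let ?r = "\<lambda>v. if v (Suc i) < v i then free_scal \<beta> * repr_word v else repr_word (?s v)"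
  have ps: "?s v permutes {1..n}" if "v permutes {1..n}" for v
    by (rule permutes_comp_simple_refl[OF that i])
  have fin: "finite ?D" "finite ?A"
    using finite_permutes by simp_all
  have bij: "bij_betw ?s ?D ?A"
  proof (rule bij_betw_byWitness[of _ ?s])
    show "?s ` ?A \<subseteq> ?D"
      using ps permutes_neq_Suc by (force simp: not_less le_less)
  qed (use ps in auto)
  have "expansion c \<otimes>\<^bsub>R\<^esub> gen \<beta> n i
      = T (\<Sum>v \<in> ?S. free_scal (c v) * (repr_word v * free_gen i))"
    unfolding expansion_def gen_def using i
    by (subst to_alg_mult[symmetric])
      (auto simp: sum_distrib_right mult.assoc intro!: sum_in_free_alg free_alg_mult_closed)
  also have "\<dots> = T (\<Sum>v \<in> ?S. free_scal (c v) * ?r v)"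
  proof (rule to_alg_sum_cong[OF finite_permutes])
    fix v assume "v \<in> ?S"
    then have v: "v permutes {1..n}" by simp
    have 1: "repr_word v * free_gen i \<in> carrier F" "?r v \<in> carrier F"
      using v ps i by (simp_all add: free_alg_mult_closed del: atLeastLessThan_iff)
    then show "free_scal (c v) * (repr_word v * free_gen i) \<in> carrier F"
      "free_scal (c v) * ?r v \<in> carrier F"
      by (simp_all only: free_alg_mult_closed free_scal_in_free_alg)
    show "T (free_scal (c v) * (repr_word v * free_gen i)) = T (free_scal (c v) * ?r v)"
      using 1 basis_elt_mult_gen[OF v i] by (simp only: to_alg_mult free_scal_in_free_alg)
  qed
  also have "(\<Sum>v \<in> ?S. free_scal (c v) * ?r v)
      = (\<Sum>v \<in> ?D. free_scal (c v) * ?r v) + (\<Sum>v \<in> ?A. free_scal (c v) * ?r v)"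
    by (subst sum.union_disjoint[symmetric]) (use fin in \<open>auto intro!: sum.cong\<close>)
  \<comment> \<open>An ascent v s_i contributes its coefficient to \<open>u_v\<close>, where
    \<open>v\<close> has the descent.\<close>
  also have "(\<Sum>v \<in> ?A. free_scal (c v) * ?r v) = (\<Sum>v \<in> ?D. free_scal (c (?s v)) * repr_word v)"
    by (subst sum.reindex_bij_betw[OF bij, symmetric]) (auto intro!: sum.cong)
  also have "(\<Sum>v \<in> ?D. free_scal (c v) * ?r v) + \<dots>
      = (\<Sum>v \<in> ?D. free_scal (hecke_act \<beta> i c v) * repr_word v)"
    unfolding sum.distrib[symmetric]
    by (rule sum.cong)
      (auto simp: hecke_act_def single_add distrib_right mult.assoc[symmetric] mult_single
        mult.commute[of \<beta>] add.commute)
  \<comment> \<open>The new coefficients vanish at ascents, so the sum may run over all permutations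
    again.\<close>
  also have "\<dots> = (\<Sum>v \<in> ?S. free_scal (hecke_act \<beta> i c v) * repr_word v)"
    by (rule sum.mono_neutral_left) (use finite_permutes in \<open>auto simp: hecke_act_def\<close>)
  finally show ?thesis by (simp only: expansion_def)
qed

lemma expansion_add:
  "expansion (\<lambda>v. c v + d v) = expansion c \<oplus>\<^bsub>R\<^esub> expansion d"
  unfolding expansion_def
  by (subst to_alg_add[symmetric])
    (auto intro!: sum_in_free_alg free_alg_mult_closed simp: sum.distrib single_add distrib_right)

lemma expansion_scale:
  "expansion (\<lambda>v. a * c v) = scal \<beta> n a \<otimes>\<^bsub>R\<^esub> expansion c"
  unfolding expansion_def scal_def
  by (subst to_alg_mult[symmetric])
    (auto intro!: sum_in_free_alg free_alg_mult_closed
      simp: sum_distrib_left mult.assoc[symmetric] mult_single)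

lemma expansion_closed [simp]: "expansion c \<in> carrier R"
  unfolding expansion_def by (auto intro!: to_alg_closed sum_in_free_alg free_alg_mult_closed)

lemma expansion_delta: "expansion (\<lambda>v. of_bool (v = id)) = \<one>\<^bsub>R\<^esub>"
proof -
  have "(\<Sum>v | v permutes {1..n}. free_scal (of_bool (v = id)) * repr_word v)
      = (\<Sum>v \<in> {id}. free_scal (of_bool (v = id)) * repr_word v)"
    by (rule sum.mono_neutral_right[OF finite_permutes]) (auto simp: permutes_id)
  then show ?thesis
    by (simp add: expansion_def to_alg_repr_word permutes_id basis_elt_id del: id_apply)
qed

text \<open>The multiplication rules exhibit a value of the definite description, namely
  \<open>w\<close> at a descent and w s_i at an ascent. Nonzero powers of \<beta> exclude any other
  value, since multiples of distinct basis elements cannot agree.\<close>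

lemma demazure_simple_refl:
  assumes w: "w permutes {1..n}" and i: "i \<in> {1..<n}" and "\<And>k. \<beta> ^ k \<noteq> 0"
  shows "demazure \<beta> n w (simple_refl i) = w \<longleftrightarrow> w (Suc i) < w i"
proof -
  let ?u = "if w (Suc i) < w i then w else w \<circ> simple_refl i"
  have asc: "w i < w (Suc i)" if "\<not> w (Suc i) < w i"
    using that permutes_neq_Suc[OF w, of i] by simp
  have u: "?u permutes {1..n}" "len n ?u \<le> len n w + 1"
    "basis_elt \<beta> n w \<otimes>\<^bsub>R\<^esub> gen \<beta> n i =
      scal \<beta> n (\<beta> ^ (len n w + 1 - len n ?u)) \<otimes>\<^bsub>R\<^esub> basis_elt \<beta> n ?u"
  proof -
    have "?u permutes {1..n} \<and> len n ?u \<le> len n w + 1 \<and>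
      basis_elt \<beta> n w \<otimes>\<^bsub>R\<^esub> gen \<beta> n i =
      scal \<beta> n (\<beta> ^ (len n w + 1 - len n ?u)) \<otimes>\<^bsub>R\<^esub> basis_elt \<beta> n ?u"
    proof (cases "w (Suc i) < w i")
      case True
      then show ?thesis using w basis_elt_mult_gen_descent[OF w i True] by simp
    next
      case False
      note p = permutes_comp_simple_refl[OF w i]
      have "scal \<beta> n 1 = \<one>\<^bsub>R\<^esub>"
        using to_alg_one by (simp add: scal_def)
      then show ?thesis
        using False p basis_elt_mult_gen_ascent[OF w i asc] len_ascent[OF w i asc]
          l_one[OF basis_elt_closed[OF p]]
        by simp
    qed
    then show "?u permutes {1..n}" "len n ?u \<le> len n w + 1"
      "basis_elt \<beta> n w \<otimes>\<^bsub>R\<^esub> gen \<beta> n i =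
      scal \<beta> n (\<beta> ^ (len n w + 1 - len n ?u)) \<otimes>\<^bsub>R\<^esub> basis_elt \<beta> n ?u"
      by blast+
  qed
  have "demazure \<beta> n w (simple_refl i) = ?u"
    unfolding demazure_def basis_elt_simple_refl[OF i]
  proof (rule the_equality)
    fix v
    assume "v permutes {1..n} \<and> len n v \<le> len n w + 1 \<and>
      basis_elt \<beta> n w \<otimes>\<^bsub>R\<^esub> gen \<beta> n i =
      scal \<beta> n (\<beta> ^ (len n w + 1 - len n v)) \<otimes>\<^bsub>R\<^esub> basis_elt \<beta> n v"
    then have "v permutes {1..n}" and
      "scal \<beta> n (\<beta> ^ (len n w + 1 - len n v)) \<otimes>\<^bsub>R\<^esub> basis_elt \<beta> n v
        = scal \<beta> n (\<beta> ^ (len n w + 1 - len n ?u)) \<otimes>\<^bsub>R\<^esub> basis_elt \<beta> n ?u"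
      unfolding u(3) by (blast intro: sym)+
    then show "v = ?u"
      by (rule basis_elt_multiple_unique[OF _ u(1) assms(3)])
  qed (use u in blast)
  moreover have "w \<circ> simple_refl i \<noteq> w"
    using permutes_neq_Suc[OF w, of i] by (metis comp_apply simple_refl_simps(1))
  ultimately show ?thesis by simp
qed

end

section \<open>The Yang-Baxter relation\<close>

lemma (in ring) ring_prod_list_commute:
  assumes "y \<in> carrier R" "\<And>k. k \<in> set ks \<Longrightarrow> f k \<in> carrier R"
    and "\<And>k. k \<in> set ks \<Longrightarrow> y \<otimes> f k = f k \<otimes> y"
  shows "y \<otimes> ring_prod_list R (map f ks) = ring_prod_list R (map f ks) \<otimes> y"
  using assms(2,3)
proof (induction ks)
  case (Cons k ks)
  let ?P = "ring_prod_list R (map f ks)"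
  have c: "f k \<in> carrier R" "?P \<in> carrier R"
    using Cons.prems(1) by (auto intro!: ring_prod_list_closed)
  have "y \<otimes> ring_prod_list R (map f (k # ks)) = (y \<otimes> f k) \<otimes> ?P"
    using c assms(1) by (simp add: m_assoc)
  also have "\<dots> = f k \<otimes> (y \<otimes> ?P)"
    using c assms(1) Cons.prems(2)[of k] by (simp add: m_assoc)
  also have "\<dots> = ring_prod_list R (map f (k # ks)) \<otimes> y"
    using c assms(1) Cons by (simp add: m_assoc)
  finally show ?case .
qed (use assms(1) in simp)

section \<open>Relations between the factors h_i(x)\<close>

locale id_coxeter_algebra_field = id_coxeter_algebra \<beta> n
  for \<beta> :: "'r::field" and n :: nat
begin

abbreviation alg_mult  (infixl \<open>\<odot>\<close> 70) where
  "x \<odot> y \<equiv> x \<otimes>\<^bsub>R\<^esub> y"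
abbreviation fgl_add  (infixl \<open>\<boxplus>\<close> 65) where
  "x \<boxplus> y \<equiv> fgl_plus \<beta> x y"
abbreviation "h \<equiv> h_elt \<beta> n"
abbreviation "A \<equiv> A_elt \<beta> n"
abbreviation "prodl \<equiv> ring_prod_list R"

lemma h_elt_eq:
  "i \<in> {1..<n} \<Longrightarrow> h i x = T (1 + free_scal x * free_gen i)"
  unfolding h_elt_def scal_def gen_def
  using F.one_closed
  by (subst to_alg_add)
    (auto simp: to_alg_one to_alg_mult free_alg_mult_closed)

lemma h_repr_in: "i \<in> {1..<n} \<Longrightarrow> 1 + free_scal x * free_gen i \<in> carrier F"
  using F.one_closed by (intro free_alg_add_closed free_alg_mult_closed) auto

lemma h_elt_closed [simp]: "i \<in> {1..<n} \<Longrightarrow> h i x \<in> carrier R"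
  using h_repr_in by (simp add: h_elt_eq)

lemma scal_relation_in_id_ideal:
  "p \<in> id_relations \<beta> n \<Longrightarrow> free_scal c * p \<in> id_ideal \<beta> n"
  using I.I_l_closed[OF id_relation_in_id_ideal free_scal_in_free_alg, of p c] by simp

lemma id_ideal_add_closed: "p \<in> id_ideal \<beta> n \<Longrightarrow> q \<in> id_ideal \<beta> n \<Longrightarrow> p + q \<in> id_ideal \<beta> n"
  using I.a_closed[of p q] by simp

lemma id_ideal_diff_closed: "p \<in> id_ideal \<beta> n \<Longrightarrow> q \<in> id_ideal \<beta> n \<Longrightarrow> p - q \<in> id_ideal \<beta> n"
  using to_alg_eq_iff[OF I.Icarr I.Icarr, of p q] to_alg_eq_zero_iff[OF I.Icarr] by metis

text \<open>The quadratic term x y u_i^2 equals \<beta> x y u_i, exactly the last term of the formal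
  group law; the difference of the two sides is x y times the quadratic relation.\<close>

lemma h_elt_mult:
  assumes i: "i \<in> {1..<n}"
  shows "h i x \<odot> h i y = h i (x \<boxplus> y)"
proof -
  have "(1 + free_scal x * free_gen i) * (1 + free_scal y * free_gen i)
      - (1 + free_scal (x \<boxplus> y) * free_gen i)
      = free_scal (x * y) * (free_gen i * free_gen i - free_scal \<beta> * free_gen i)"
    by (simp add: fgl_plus_def mult_single algebra_simps single_add single_diff)
  moreover have "free_gen i * free_gen i - free_scal \<beta> * free_gen i \<in> id_relations \<beta> n"
    using i by (auto simp: id_relations_def)
  ultimately show ?thesis
    using i h_repr_in scal_relation_in_id_ideal
    by (simp add: h_elt_eq to_alg_mult[symmetric] to_alg_eq_iff free_alg_mult_closed
        del: atLeastLessThan_iff)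
qed

lemma h_elt_commute:
  assumes i: "i \<in> {1..<n}" "j \<in> {1..<n}" "\<bar>int i - int j\<bar> > 1"
  shows "h i x \<odot> h j y = h j y \<odot> h i x"
proof -
  have "(1 + free_scal x * free_gen i) * (1 + free_scal y * free_gen j)
      - (1 + free_scal y * free_gen j) * (1 + free_scal x * free_gen i)
      = free_scal (x * y) * (free_gen i * free_gen j - free_gen j * free_gen i)"
    by (simp add: mult_single algebra_simps)
  moreover have "free_gen i * free_gen j - free_gen j * free_gen i \<in> id_relations \<beta> n"
    using i unfolding id_relations_def by blast
  ultimately show ?thesis
    using i h_repr_in scal_relation_in_id_ideal
    by (simp add: h_elt_eq to_alg_mult[symmetric] to_alg_eq_iff free_alg_mult_closed
        del: atLeastLessThan_iff)
qed

lemma h_elt_Yang_Baxter: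
  assumes i: "i \<in> {1..<n}" "Suc i \<in> {1..<n}"
  shows "h i y \<odot> h (Suc i) (x \<boxplus> y) \<odot> h i x = h (Suc i) x \<odot> h i (x \<boxplus> y) \<odot> h (Suc i) y"
proof -
  let ?z = "x \<boxplus> y" and ?g = "free_gen i :: nat fmon \<Rightarrow>\<^sub>0 'r" and ?k = "free_gen (Suc i) :: nat fmon \<Rightarrow>\<^sub>0 'r"
  let ?p = "(1 + free_scal y * ?g) * (1 + free_scal ?z * ?k) * (1 + free_scal x * ?g)"
  let ?q = "(1 + free_scal x * ?k) * (1 + free_scal ?z * ?g) * (1 + free_scal y * ?k)"
  \<comment> \<open>The mixed quadratic terms cancel. What remains are two quadratic relations,
    whose linear parts come from x + y - (x \<oplus> y) = - \<beta> x y, and one braid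
    relation.\<close>
  have "?p - ?q
      = free_scal (x * y) * (?g * ?g - free_scal \<beta> * ?g)
        - free_scal (x * y) * (?k * ?k - free_scal \<beta> * ?k)
        + free_scal (x * y * ?z) * (?g * ?k * ?g - ?k * ?g * ?k)"
    by (simp add: fgl_plus_def mult_single algebra_simps single_add single_diff)
  moreover have "?g * ?g - free_scal \<beta> * ?g \<in> id_relations \<beta> n"
    "?k * ?k - free_scal \<beta> * ?k \<in> id_relations \<beta> n"
    "?g * ?k * ?g - ?k * ?g * ?k \<in> id_relations \<beta> n"
    using i by (auto simp: id_relations_def)
  then have "free_scal (x * y) * (?g * ?g - free_scal \<beta> * ?g)
        - free_scal (x * y) * (?k * ?k - free_scal \<beta> * ?k)
        + free_scal (x * y * ?z) * (?g * ?k * ?g - ?k * ?g * ?k) \<in> id_ideal \<beta> n"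
    by (intro scal_relation_in_id_ideal id_ideal_add_closed id_ideal_diff_closed)
  ultimately have "T ?p = T ?q"
    using i h_repr_in by (subst to_alg_eq_iff) (auto intro!: free_alg_mult_closed)
  then show ?thesis
    using i h_repr_in
    by (simp add: h_elt_eq to_alg_mult free_alg_mult_closed del: atLeastLessThan_iff)
qed

lemma h_elt_zero: "i \<in> {1..<n} \<Longrightarrow> h i 0 = \<one>\<^bsub>R\<^esub>"
  by (simp add: h_elt_eq to_alg_one del: atLeastLessThan_iff)

section \<open>Moving the factors B_j through the factors A_k\<close>

definition B_elt :: "nat \<Rightarrow> 'r \<Rightarrow> (nat fmon \<Rightarrow>\<^sub>0 'r) set" where
  "B_elt i x = prodl (map (\<lambda>k. h k x) [i..<n])"

lemma A_elt_closed [simp]: "1 \<le> i \<Longrightarrow> A i x \<in> carrier R"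
  unfolding A_elt_def by (rule ring_prod_list_closed) auto

lemma B_elt_closed [simp]: "1 \<le> i \<Longrightarrow> B_elt i x \<in> carrier R"
  unfolding B_elt_def by (rule ring_prod_list_closed) auto

lemma A_elt_n [simp]: "A n x = \<one>\<^bsub>R\<^esub>"
  by (simp add: A_elt_def)

lemma B_elt_n [simp]: "B_elt n x = \<one>\<^bsub>R\<^esub>"
  by (simp add: B_elt_def)

lemma A_elt_rec:
  assumes "1 \<le> i" "i < n"
  shows "A i x = A (Suc i) x \<odot> h i x"
proof -
  have "map (\<lambda>k. h k x) (rev [i..<n]) = map (\<lambda>k. h k x) (rev [Suc i..<n]) @ [h i x]"
    using assms by (simp add: upt_conv_Cons)
  then show ?thesis
    unfolding A_elt_def using assms by (simp, subst ring_prod_list_append) auto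
qed

lemma B_elt_rec: "i < n \<Longrightarrow> B_elt i x = h i x \<odot> B_elt (Suc i) x"
  by (simp add: B_elt_def upt_conv_Cons)

lemma h_A_commute:
  assumes "1 \<le> j" "j < n" "Suc j < i"
  shows "h j y \<odot> A i x = A i x \<odot> h j y"
  unfolding A_elt_def
proof (rule ring_prod_list_commute)
  fix k assume k: "k \<in> set (rev [i..<n])"
  then show "h k x \<in> carrier R"
    using assms by (intro h_elt_closed) auto
  show "h j y \<odot> h k x = h k x \<odot> h j y"
    by (rule h_elt_commute) (use k assms in auto)
qed (use assms in simp)

text \<open>Induction downwards from j = n-1: the outer factors h_j enclose the identity for j+1,
  commute past everything with index at least j+2, and meet the middle factor, where the Yang-Baxter
  relation applies.\<close>

lemma B_elt_mult_A_elt: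
  assumes "1 \<le> j" "j < n"
  shows "B_elt j y \<odot> A j x = A (Suc j) x \<odot> h j (x \<boxplus> y) \<odot> B_elt (Suc j) y"
  using assms
proof (induction "n - j" arbitrary: j)
  case (Suc d)
  show ?case
  proof (cases "Suc j = n")
    case True
    have "h j y \<odot> h j x = h j (x \<boxplus> y)"
      using Suc.prems h_elt_mult[of j y x] by (simp add: fgl_plus_def algebra_simps)
    then show ?thesis using True Suc.prems by (simp add: A_elt_rec B_elt_rec)
  next
    case False
    let ?j = "Suc j" and ?z = "x \<boxplus> y"
    have j: "j \<in> {1..<n}" "?j \<in> {1..<n}" "1 \<le> ?j" "?j < n" "1 \<le> Suc ?j" "1 \<le> j" "j < n"
      using Suc.prems False by auto
    note cl = h_elt_closed[OF j(1)] h_elt_closed[OF j(2)] A_elt_closed[OF j(3)] A_elt_closed[OF j(5)]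
      B_elt_closed[OF j(3)] B_elt_closed[OF j(5)] m_closed
    have "B_elt j y \<odot> A j x = h j y \<odot> (B_elt ?j y \<odot> A ?j x) \<odot> h j x"
      using cl j by (simp only: A_elt_rec B_elt_rec m_assoc)
    also have "B_elt ?j y \<odot> A ?j x = A (Suc ?j) x \<odot> h ?j ?z \<odot> B_elt (Suc ?j) y"
      using Suc.hyps(1)[of ?j] Suc.hyps(2) j by simp
    also have "h j y \<odot> \<dots> \<odot> h j x = (h j y \<odot> A (Suc ?j) x) \<odot> h ?j ?z \<odot> (B_elt (Suc ?j) y \<odot> h j x)"
      using cl by (simp only: m_assoc)
    also have "h j y \<odot> A (Suc ?j) x = A (Suc ?j) x \<odot> h j y"
      using j by (intro h_A_commute) auto
    also have "B_elt (Suc ?j) y \<odot> h j x = h j x \<odot> B_elt (Suc ?j) y"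
      unfolding B_elt_def
    proof (rule ring_prod_list_commute[symmetric])
      fix k assume k: "k \<in> set [Suc ?j..<n]"
      then show "h k y \<in> carrier R"
        using j by (intro h_elt_closed) auto
      show "h j x \<odot> h k y = h k y \<odot> h j x"
        by (rule h_elt_commute) (use k j in auto)
    qed (use j in simp)
    also have "A (Suc ?j) x \<odot> h j y \<odot> h ?j ?z \<odot> (h j x \<odot> B_elt (Suc ?j) y)
        = A (Suc ?j) x \<odot> (h j y \<odot> h ?j ?z \<odot> h j x) \<odot> B_elt (Suc ?j) y"
      using cl by (simp only: m_assoc)
    also have "h j y \<odot> h ?j ?z \<odot> h j x = h ?j x \<odot> h j ?z \<odot> h ?j y"
      by (rule h_elt_Yang_Baxter[OF j(1,2)])
    also have "A (Suc ?j) x \<odot> (h ?j x \<odot> h j ?z \<odot> h ?j y) \<odot> B_elt (Suc ?j) y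
        = A ?j x \<odot> h j ?z \<odot> B_elt ?j y"
      using cl j by (simp only: A_elt_rec[of ?j] B_elt_rec[of ?j] m_assoc)
    finally show ?thesis .
  qed
qed simp

text \<open>Passing one factor A_k raises its index, keeps its argument and releases one factor h_k.
  Each released factor commutes with the raised factors still to come, whose indices are larger by
  at least two, so these factors gather on the right.\<close>

lemma B_elt_mult_A_elts:
  assumes "1 \<le> j" "j \<le> n"
  shows "B_elt j y \<odot> prodl (map (\<lambda>k. A k (c k)) [j..<n])
    = prodl (map (\<lambda>k. A (Suc k) (c k)) [j..<n]) \<odot> prodl (map (\<lambda>k. h k (c k \<boxplus> y)) [j..<n])"
  using assms
proof (induction "n - j" arbitrary: j)
  case (Suc d)
  let ?j = "Suc j"
  let ?S = "\<lambda>j. prodl (map (\<lambda>k. A k (c k)) [j..<n])"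
  let ?S' = "\<lambda>j. prodl (map (\<lambda>k. A (Suc k) (c k)) [j..<n])"
  let ?R = "\<lambda>j. prodl (map (\<lambda>k. h k (c k \<boxplus> y)) [j..<n])"
  have j: "1 \<le> j" "j < n" "1 \<le> ?j" "j \<in> {1..<n}" "?j \<le> n"
    using Suc by auto
  have upt: "[j..<n] = j # [?j..<n]"
    using j by (simp add: upt_conv_Cons)
  have cl1: "?S ?j \<in> carrier R" "?S' ?j \<in> carrier R"
    "?R ?j \<in> carrier R"
    by (rule ring_prod_list_closed, auto)+
  note cl = cl1 A_elt_closed[OF j(1)] A_elt_closed[OF j(3)] B_elt_closed[OF j(1)]
    B_elt_closed[OF j(3)] h_elt_closed[OF j(4)] m_closed
  have comm: "h j z \<odot> ?S' ?j = ?S' ?j \<odot> h j z" for z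
  proof (rule ring_prod_list_commute)
    fix k assume k: "k \<in> set [?j..<n]"
    then show "A (Suc k) (c k) \<in> carrier R"
      by (intro A_elt_closed) auto
    show "h j z \<odot> A (Suc k) (c k) = A (Suc k) (c k) \<odot> h j z"
      by (rule h_A_commute) (use k j in auto)
  qed (use j in simp)
  have "B_elt j y \<odot> ?S j = (B_elt j y \<odot> A j (c j)) \<odot> ?S ?j"
    using cl by (simp only: upt list.map ring_prod_list_Cons m_assoc)
  also have "\<dots> = A ?j (c j) \<odot> h j (c j \<boxplus> y) \<odot> (B_elt ?j y \<odot> ?S ?j)"
    using cl by (simp only: B_elt_mult_A_elt[OF j(1,2)] m_assoc)
  also have "B_elt ?j y \<odot> ?S ?j = ?S' ?j \<odot> ?R ?j"
    using Suc.hyps(1)[of ?j] Suc.hyps(2) j by simp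
  also have "A ?j (c j) \<odot> h j (c j \<boxplus> y) \<odot> (?S' ?j \<odot> ?R ?j)
      = A ?j (c j) \<odot> (h j (c j \<boxplus> y) \<odot> ?S' ?j) \<odot> ?R ?j"
    using cl by (simp only: m_assoc)
  also have "\<dots> = ?S' j \<odot> ?R j"
    using cl by (simp only: comm upt list.map ring_prod_list_Cons m_assoc)
  finally show ?case .
qed simp

definition box_elt :: "(nat \<Rightarrow> 'r) \<Rightarrow> (nat \<Rightarrow> 'r) \<Rightarrow> nat \<times> nat \<Rightarrow> (nat fmon \<Rightarrow>\<^sub>0 'r) set" where
  "box_elt a b d = h (box_index d) (box_wt \<beta> a b d)"

text \<open>The factor B_k stands next to the A's and is moved first; it releases the boxes with j =
  k and raises the indices of all A's. Hence at stage k the factor A_m carries the argument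
  a_{m+1-k}, and k = 1 is the original product.\<close>

lemma B_elts_mult_A_elts:
  assumes "1 \<le> k" "k \<le> n"
  shows "prodl (map (\<lambda>j. B_elt j (b j)) (rev [k..<n])) \<odot> prodl (map (\<lambda>m. A m (a (Suc m - k))) [k..<n])
    = prodl (map (box_elt a b) (concat (map (\<lambda>j. map (\<lambda>i. (i, j)) [1..<Suc (n - j)]) (rev [k..<n]))))"
  using assms
proof (induction "n - k" arbitrary: k)
  case (Suc d)
  let ?k = "Suc k"
  let ?B = "\<lambda>k. prodl (map (\<lambda>j. B_elt j (b j)) (rev [k..<n]))"
  let ?row = "\<lambda>j. map (\<lambda>i. (i, j)) [1..<Suc (n - j)]"
  let ?D = "\<lambda>k. concat (map ?row (rev [k..<n]))"
  let ?A = "\<lambda>m. A m (a (m - k))"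
  have k: "1 \<le> k" "k < n" "1 \<le> ?k" "?k \<le> n" "k \<le> n"
    using Suc by auto
  have upt: "rev [k..<n] = rev [?k..<n] @ [k]"
    using k by (simp add: upt_conv_Cons)
  \<comment> \<open>The substitution is m = i + k - 1, the index of the simple reflection in box (i,
    k).\<close>
  have row: "map (\<lambda>m. h m (a (Suc m - k) \<boxplus> b k)) [k..<n] = map (box_elt a b) (?row k)"
    using k by (intro nth_equalityI)
      (simp_all add: box_elt_def box_index_def box_wt_def add.commute del: upt_Suc)
  have boxes: "set (map (box_elt a b) (?D j)) \<subseteq> carrier R"
    "set (map (box_elt a b) (?row j)) \<subseteq> carrier R" if "1 \<le> j" for j
    using that by (auto simp: box_elt_def box_index_def intro!: h_elt_closed)
  have cB: "?B j \<in> carrier R" if "1 \<le> j" for j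
    by (rule ring_prod_list_closed) (use that in auto)
  have cA: "prodl (map ?A [j..<m]) \<in> carrier R" if "1 \<le> j" for j m
    by (rule ring_prod_list_closed) (use that in auto)
  have B: "?B k = ?B ?k \<odot> B_elt k (b k)"
    unfolding upt map_append using k by (subst ring_prod_list_append) auto
  have D: "prodl (map (box_elt a b) (?D k))
      = prodl (map (box_elt a b) (?D ?k)) \<odot> prodl (map (box_elt a b) (?row k))"
    unfolding upt map_append concat_append
    using boxes[OF k(1)] boxes[OF k(3)]
    by (subst ring_prod_list_append) (simp_all del: upt_Suc map_map)
  \<comment> \<open>After raising the indices the top factor is A_n, an empty product equal to
    one.\<close>
  have shift: "prodl (map (\<lambda>m. A (Suc m) (a (Suc m - k))) [k..<n]) = prodl (map ?A [?k..<n])"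
  proof -
    have "map (\<lambda>m. A (Suc m) (a (Suc m - k))) [k..<n] = map ?A (map Suc [k..<n])"
      by simp
    also have "\<dots> = map ?A [?k..<n] @ [\<one>\<^bsub>R\<^esub>]"
      using k by (simp add: map_Suc_upt)
    finally show ?thesis
      using cA[OF k(3), of n] k by (simp only:) (subst ring_prod_list_append, auto)
  qed
  have "?B k \<odot> prodl (map (\<lambda>m. A m (a (Suc m - k))) [k..<n])
      = ?B ?k \<odot> (B_elt k (b k) \<odot> prodl (map (\<lambda>m. A m (a (Suc m - k))) [k..<n]))"
    unfolding B
    by (rule m_assoc[OF cB[OF k(3)] B_elt_closed[OF k(1)]]) (rule ring_prod_list_closed, use k in auto)
  also have "\<dots> = ?B ?k \<odot> (prodl (map ?A [?k..<n]) \<odot> prodl (map (box_elt a b) (?row k)))"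
    by (simp only: B_elt_mult_A_elts[OF k(1,5)] shift row)
  also have "\<dots> = (?B ?k \<odot> prodl (map ?A [?k..<n])) \<odot> prodl (map (box_elt a b) (?row k))"
    using cB[OF k(3)] cA[OF k(3)] ring_prod_list_closed[OF boxes(2)[OF k(1)]]
    by (simp only: m_assoc)
  also have "?B ?k \<odot> prodl (map ?A [?k..<n]) = prodl (map (box_elt a b) (?D ?k))"
    using Suc.hyps(1)[of ?k] Suc.hyps(2) k by (simp only: diff_Suc_Suc)
  finally show ?case
    using D by simp
qed simp

text \<open>Nonvanishing of 1 + \<beta> b_i makes the formal negative a true inverse for \<oplus>.
  So each B_i inverts the corresponding A_i on both sides, and the B's in reverse order invert the
  whole product.\<close>

lemma G_elt_inverse_mult:
  assumes b: "\<And>i. i \<in> {1..<n} \<Longrightarrow> 1 + \<beta> * b i \<noteq> 0"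
    and "1 \<le> n"
  shows "inv\<^bsub>R\<^esub> (G_elt \<beta> n (\<lambda>i. fgl_neg \<beta> (b i))) \<odot> G_elt \<beta> n a
    = prodl (map (box_elt a b) (Delta n))"
proof -
  let ?B = "prodl (map (\<lambda>j. B_elt j (b j)) (rev [1..<n]))"
  let ?G = "G_elt \<beta> n (\<lambda>i. fgl_neg \<beta> (b i))"
  have z: "fgl_neg \<beta> (b i) \<boxplus> b i = 0" "b i \<boxplus> fgl_neg \<beta> (b i) = 0" if "i \<in> {1..<n}" for i
    using b[OF that] by (simp_all add: fgl_plus_def fgl_neg_def field_simps)
  have AB: "A i (fgl_neg \<beta> (b i)) \<odot> B_elt i (b i) = \<one>\<^bsub>R\<^esub>"
    "B_elt i (b i) \<odot> A i (fgl_neg \<beta> (b i)) = \<one>\<^bsub>R\<^esub>" if i: "i \<in> {1..<n}" for i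
  proof -
    have hh: "h k (fgl_neg \<beta> (b i)) \<odot> h k (b i) = \<one>\<^bsub>R\<^esub>"
      "h k (b i) \<odot> h k (fgl_neg \<beta> (b i)) = \<one>\<^bsub>R\<^esub>" if "k \<in> set [i..<n]" for k
    proof -
      have "k \<in> {1..<n}" using that i by auto
      then show "h k (fgl_neg \<beta> (b i)) \<odot> h k (b i) = \<one>\<^bsub>R\<^esub>"
        "h k (b i) \<odot> h k (fgl_neg \<beta> (b i)) = \<one>\<^bsub>R\<^esub>"
        by (simp_all only: h_elt_mult z[OF i] h_elt_zero)
    qed
    show "A i (fgl_neg \<beta> (b i)) \<odot> B_elt i (b i) = \<one>\<^bsub>R\<^esub>"
      unfolding A_elt_def B_elt_def
      using ring_prod_list_inverse[of "rev [i..<n]" "\<lambda>k. h k (fgl_neg \<beta> (b i))" "\<lambda>k. h k (b i)"]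
        hh(1) i by auto
    show "B_elt i (b i) \<odot> A i (fgl_neg \<beta> (b i)) = \<one>\<^bsub>R\<^esub>"
      unfolding A_elt_def B_elt_def
      using ring_prod_list_inverse[of "[i..<n]" "\<lambda>k. h k (b i)" "\<lambda>k. h k (fgl_neg \<beta> (b i))"]
        hh(2) i by auto
  qed
  have GB: "?G \<odot> ?B = \<one>\<^bsub>R\<^esub>"
    unfolding G_elt_def by (rule ring_prod_list_inverse) (use AB in auto)
  have BG: "?B \<odot> ?G = \<one>\<^bsub>R\<^esub>"
    unfolding G_elt_def
    using ring_prod_list_inverse[of "rev [1..<n]" "\<lambda>j. B_elt j (b j)" "\<lambda>j. A j (fgl_neg \<beta> (b j))"] AB
    by auto
  have "?G \<in> carrier R" "?B \<in> carrier R"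
    unfolding G_elt_def by (rule ring_prod_list_closed, auto)+
  then have "inv\<^bsub>R\<^esub> ?G = ?B"
    by (rule inv_unique'[OF _ _ GB BG, symmetric])
  then show ?thesis
    using B_elts_mult_A_elts[of 1 b a] \<open>1 \<le> n\<close> by (simp add: Delta_def G_elt_def del: upt_Suc)
qed

end

section \<open>Subwords\<close>

definition box_word :: "(nat \<times> nat) list \<Rightarrow> nat list \<Rightarrow> nat list" where
  "box_word ds js = map (\<lambda>j. box_index (ds ! j)) js"

lemma sub_prod_eq: "sub_prod ds js = word_prod (box_word ds js)"
  by (simp add: sub_prod_def box_word_def)

text \<open>Reading the chosen boxes as a word lets the results on reduced words apply to
  subsequences.\<close>

lemma RSub_iff:
  assumes "box_index ` set ds \<subseteq> {1..<n}"
  shows "js \<in> RSub n ds v \<longleftrightarrow>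
    sorted_wrt (<) js \<and> set js \<subseteq> {..<length ds} \<and> reduced_word n v (box_word ds js)"
proof -
  have "set (box_word ds js) \<subseteq> {1..<n}" if "set js \<subseteq> {..<length ds}"
  proof -
    have "set (box_word ds js) \<subseteq> box_index ` set ds"
      using that by (force simp: box_word_def)
    then show ?thesis by (rule subset_trans[OF _ assms])
  qed
  moreover have "length (box_word ds js) = length js"
    by (simp add: box_word_def)
  ultimately show ?thesis
    unfolding RSub_def reduced_word_def mem_Collect_eq sub_prod_eq by metis
qed

lemma finite_RSub: "finite (RSub n ds v)"
  by (rule finite_subset[OF _ finite_lists_length_eq[of "{..<length ds}" "len n v"]])
    (auto simp: RSub_def)

lemma RSub_Nil: "RSub n [] v = (if v = id then {[]} else {})"
  by (auto simp: RSub_def sub_prod_def)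

lemma box_word_append1:
  "set js \<subseteq> {..<length ds} \<Longrightarrow> box_word (ds @ [d]) js = box_word ds js"
  by (auto simp: box_word_def nth_append)

lemma sub_prod_append1:
  "set js \<subseteq> {..<length ds} \<Longrightarrow> sub_prod (ds @ [d]) js = sub_prod ds js"
  by (simp only: sub_prod_eq box_word_append1)

lemma sorted_wrt_less_last:
  assumes "sorted_wrt (<) js" "set js \<subseteq> {..<Suc m}" "m \<in> set js"
  shows "\<exists>ks. js = ks @ [m] \<and> set ks \<subseteq> {..<m}"
proof -
  from assms(3) obtain ks k where js: "js = ks @ [k]"
    by (cases js rule: rev_cases) auto
  have "m = k"
  proof (rule ccontr)
    assume "m \<noteq> k"
    then have "m \<in> set ks" using assms(3) js by simp
    then have "m < k" using assms(1) js by (auto simp: sorted_wrt_append)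
    then show False using assms(2) js by auto
  qed
  then show ?thesis using assms(1) js by (auto simp: sorted_wrt_append)
qed

text \<open>Either the last box is skipped, or it is the last letter of a reduced word; by
  \<open>reduced_word_snoc\<close> that needs a descent and leaves a subword for v s_i.\<close>

lemma RSub_snoc:
  assumes ds: "box_index ` set (ds @ [d]) \<subseteq> {1..<n}" and v: "v permutes {1..n}"
  shows "RSub n (ds @ [d]) v = RSub n ds v \<union>
    (if v (Suc (box_index d)) < v (box_index d)
     then (\<lambda>js. js @ [length ds]) ` RSub n ds (v \<circ> simple_refl (box_index d)) else {})"
    (is "?L = ?R1 \<union> ?R2")
proof -
  let ?i = "box_index d" and ?N = "length ds"
  have ds': "box_index ` set ds \<subseteq> {1..<n}" using ds by auto
  have i: "?i \<in> {1..<n}" using ds by auto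
  have word: "box_word (ds @ [d]) (ks @ [?N]) = box_word ds ks @ [?i]" if "set ks \<subseteq> {..<?N}" for ks
    using box_word_append1[OF that, of d] by (simp add: box_word_def)
  show ?thesis
  proof (intro equalityI subsetI)
    fix js assume js: "js \<in> ?L"
    then have 1: "sorted_wrt (<) js" "set js \<subseteq> {..<Suc ?N}" "reduced_word n v (box_word (ds @ [d]) js)"
      unfolding RSub_iff[OF ds] by auto
    show "js \<in> ?R1 \<union> ?R2"
    proof (cases "?N \<in> set js")
      case False
      then have "set js \<subseteq> {..<?N}" using 1(2) by (auto simp: less_Suc_eq)
      then have "js \<in> ?R1" unfolding RSub_iff[OF ds'] using 1 box_word_append1 by metis
      then show ?thesis by simp
    next
      case True
      from sorted_wrt_less_last[OF 1(1,2) True] obtain ks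
        where ks: "js = ks @ [?N]" "set ks \<subseteq> {..<?N}" by blast
      have "reduced_word n v (box_word ds ks @ [?i])"
        using 1(3) ks word by simp
      then have "v (Suc ?i) < v ?i" "reduced_word n (v \<circ> simple_refl ?i) (box_word ds ks)"
        using reduced_word_snoc[OF v] by auto
      moreover from this have "ks \<in> RSub n ds (v \<circ> simple_refl ?i)"
        unfolding RSub_iff[OF ds'] using 1(1) ks by (simp add: sorted_wrt_append)
      ultimately show ?thesis using ks by auto
    qed
  next
    fix js assume "js \<in> ?R1 \<union> ?R2"
    then consider "js \<in> ?R1" | ks where "js = ks @ [?N]" "v (Suc ?i) < v ?i"
      "ks \<in> RSub n ds (v \<circ> simple_refl ?i)"
      by (auto split: if_splits)
    then show "js \<in> ?L"
    proof cases
      case 1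
      then have "set js \<subseteq> {..<?N}" unfolding RSub_iff[OF ds'] by simp
      with 1 show ?thesis
        unfolding RSub_iff[OF ds] RSub_iff[OF ds'] using box_word_append1[of js ds d] by auto
    next
      case (2 ks)
      then have "set ks \<subseteq> {..<?N}" unfolding RSub_iff[OF ds'] by simp
      with 2 i word[of ks] reduced_word_snoc[OF v] show ?thesis
        unfolding RSub_iff[OF ds] RSub_iff[OF ds'] by (auto simp: sorted_wrt_append)
    qed
  qed
qed

lemma B_set_subset: "B_set \<beta> n ds js \<subseteq> {..<length ds}"
  by (auto simp: B_set_def)

text \<open>The new position falls into the gap after the last chosen one, where the partial product
  is the whole product. An empty choice has no such gap, which accounts for the condition on
  \<open>js\<close>.\<close>

lemma B_set_snoc_skip:
  assumes js: "set js \<subseteq> {..<length ds}"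
  shows "B_set \<beta> n (ds @ [d]) js = B_set \<beta> n ds js \<union>
    (if js \<noteq> [] \<and> demazure \<beta> n (sub_prod ds js) (simple_refl (box_index d)) = sub_prod ds js
     then {length ds} else {})" (is "?L = ?R1 \<union> ?R2")
proof -
  let ?N = "length ds"
  let ?dem = "\<lambda>p i. demazure \<beta> n (sub_prod ds (take (Suc p) js)) (simple_refl i)
    = sub_prod ds (take (Suc p) js)"
  have lt: "js ! p < ?N" if "p < length js" for p
    using that js nth_mem by blast
  have sub: "sub_prod (ds @ [d]) (take (Suc p) js) = sub_prod ds (take (Suc p) js)" for p
    by (rule sub_prod_append1) (use js in \<open>auto dest: in_set_takeD\<close>)
  have mem: "j \<in> B_set \<beta> n (ds @ [d]) js \<longleftrightarrow> j < Suc ?N \<and>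
      (\<exists>p < length js. js ! p < j \<and> j < (js @ [Suc ?N]) ! Suc p \<and> ?dem p (box_index ((ds @ [d]) ! j)))" for j
    by (simp add: B_set_def sub)
  have "j \<in> ?L \<longleftrightarrow> j \<in> ?R1 \<union> ?R2" for j
  proof -
    consider "j < ?N" | "j = ?N" | "j > ?N" by linarith
    then show ?thesis
    proof cases
      \<comment> \<open>For positions before the new one it makes no difference which of the two
        lengths closes the last gap.\<close>
      case 1
      have "j < (js @ [Suc ?N]) ! Suc p \<longleftrightarrow> j < (js @ [?N]) ! Suc p" if "p < length js" for p
        using 1 that by (cases "Suc p = length js") (auto simp: nth_append)
      with 1 show ?thesis unfolding mem by (auto simp: B_set_def nth_append split: if_splits)
    next
      case 2
      have "js ! p < ?N \<and> ?N < (js @ [Suc ?N]) ! Suc p \<longleftrightarrow> Suc p = length js" if "p < length js" for p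
        using that lt[of p] lt[of "Suc p"] by (cases "Suc p = length js") (auto simp: nth_append)
      then have "j \<in> ?L \<longleftrightarrow> (\<exists>p < length js. Suc p = length js \<and> ?dem p (box_index d))"
        unfolding mem 2 nth_append_length by blast
      also have "\<dots> \<longleftrightarrow> j \<in> ?R2"
        using 2 by (cases js) auto
      also have "\<dots> \<longleftrightarrow> j \<in> ?R1 \<union> ?R2"
        using 2 B_set_subset[of \<beta> n ds js] by auto
      finally show ?thesis .
    next
      case 3
      then show ?thesis using B_set_subset[of \<beta> n ds js] unfolding mem by auto
    qed
  qed
  then show ?thesis by blast
qed

text \<open>The chosen new position takes the place of the former end mark, so the old gaps stay the
  same and no position lies beyond it.\<close>

lemma B_set_snoc_take:
  assumes js: "set js \<subseteq> {..<length ds}"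
  shows "B_set \<beta> n (ds @ [d]) (js @ [length ds]) = B_set \<beta> n ds js"
proof -
  let ?N = "length ds"
  have sub: "sub_prod (ds @ [d]) (take (Suc p) js) = sub_prod ds (take (Suc p) js)" for p
    by (rule sub_prod_append1) (use js in \<open>auto dest: in_set_takeD\<close>)
  have le: "(js @ [?N]) ! p \<le> ?N" if "p < Suc (length js)" for p
  proof (cases "p < length js")
    case True
    then have "js ! p < ?N" using js nth_mem by blast
    with True show ?thesis by (simp add: nth_append)
  qed (use that in \<open>simp add: nth_append\<close>)
  have "j \<in> B_set \<beta> n (ds @ [d]) (js @ [?N]) \<longleftrightarrow> j \<in> B_set \<beta> n ds js" for j
  proof
    assume "j \<in> B_set \<beta> n (ds @ [d]) (js @ [?N])"
    then obtain p where j: "j < Suc ?N" and p: "p < Suc (length js)" "(js @ [?N]) ! p < j"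
      "j < ((js @ [?N]) @ [Suc ?N]) ! Suc p"
      "demazure \<beta> n (sub_prod (ds @ [d]) (take (Suc p) (js @ [?N])))
          (simple_refl (box_index ((ds @ [d]) ! j)))
        = sub_prod (ds @ [d]) (take (Suc p) (js @ [?N]))"
      by (auto simp: B_set_def)
    have pl: "p < length js"
    proof (rule ccontr)
      assume "\<not> p < length js"
      then have "p = length js" using p(1) by simp
      then show False using p(2) j by simp
    qed
    then have lt: "j < (js @ [?N]) ! Suc p"
      using p(3) by (simp only: nth_append length_append_singleton) (simp add: nth_append)
    with le[of "Suc p"] pl have "j < ?N" by simp
    with p pl lt sub show "j \<in> B_set \<beta> n ds js"
      by (auto simp: B_set_def nth_append)
  next
    assume "j \<in> B_set \<beta> n ds js"
    then obtain p where j: "j < ?N" and p: "p < length js" "js ! p < j" "j < (js @ [?N]) ! Suc p"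
      "demazure \<beta> n (sub_prod ds (take (Suc p) js)) (simple_refl (box_index (ds ! j)))
        = sub_prod ds (take (Suc p) js)"
      by (auto simp: B_set_def)
    have "j < ((js @ [?N]) @ [Suc ?N]) ! Suc p"
      using p by (simp only: nth_append length_append_singleton) (simp add: nth_append)
    with j p sub show "j \<in> B_set \<beta> n (ds @ [d]) (js @ [?N])"
      unfolding B_set_def by (auto simp: nth_append intro!: exI[of _ p])
  qed
  then show ?thesis by blast
qed

section \<open>The weighted sum over subwords as coefficients of the product\<close>

context id_coxeter_algebra_field
begin

definition subword_sum :: "(nat \<Rightarrow> 'r) \<Rightarrow> (nat \<Rightarrow> 'r) \<Rightarrow> (nat \<times> nat) list \<Rightarrow> (nat \<Rightarrow> nat) \<Rightarrow> 'r" where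
  "subword_sum a b ds v = (\<Sum>js \<in> RSub n ds v. sub_Wt \<beta> n a b ds js)"

lemma subword_sum_Nil: "subword_sum a b [] v = of_bool (v = id)"
  by (simp add: subword_sum_def RSub_Nil sub_Wt_def B_set_def)

lemma subword_sum_not_permutes:
  assumes "box_index ` set ds \<subseteq> {1..<n}" "\<not> v permutes {1..n}"
  shows "subword_sum a b ds v = 0"
proof -
  have "RSub n ds v = {}"
    using RSub_iff[OF assms(1)] reduced_word_permutes assms(2) by blast
  then show ?thesis by (simp add: subword_sum_def)
qed

lemma sub_Wt_snoc_skip:
  assumes ds: "box_index ` set (ds @ [d]) \<subseteq> {1..<n}" and v: "v permutes {1..n}"
    and js: "js \<in> RSub n ds v" and \<beta>: "\<And>k. \<beta> ^ k \<noteq> 0"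
  shows "sub_Wt \<beta> n a b (ds @ [d]) js = sub_Wt \<beta> n a b ds js *
    (if v (Suc (box_index d)) < v (box_index d) then 1 + \<beta> * box_wt \<beta> a b d else 1)"
proof -
  let ?N = "length ds" and ?i = "box_index d"
  have js': "set js \<subseteq> {..<?N}" "sub_prod ds js = v" "length js = len n v"
    using js by (auto simp: RSub_def)
  have i: "?i \<in> {1..<n}" using ds by auto
  \<comment> \<open>An empty choice occurs only for the identity, which has no descent, so both
    sides fail together.\<close>
  have desc: "js \<noteq> [] \<and> demazure \<beta> n v (simple_refl ?i) = v \<longleftrightarrow> v (Suc ?i) < v ?i"
    using demazure_simple_refl[OF v i \<beta>] len_eq_0_iff[OF v] js'(3) by auto
  have box: "(\<Prod>j \<in> set js. box_wt \<beta> a b ((ds @ [d]) ! j)) = (\<Prod>j \<in> set js. box_wt \<beta> a b (ds ! j))"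
    by (rule prod.cong) (use js' in \<open>auto simp: nth_append\<close>)
  have B: "B_set \<beta> n ds js \<subseteq> {..<?N}" by (rule B_set_subset)
  then have fin: "finite (B_set \<beta> n ds js)" by (rule finite_subset) simp
  have notin: "?N \<notin> B_set \<beta> n ds js" using B by blast
  have old: "(\<Prod>j \<in> B_set \<beta> n ds js. 1 + \<beta> * box_wt \<beta> a b ((ds @ [d]) ! j))
      = (\<Prod>j \<in> B_set \<beta> n ds js. 1 + \<beta> * box_wt \<beta> a b (ds ! j))"
    by (rule prod.cong) (use B in \<open>auto simp: nth_append\<close>)
  show ?thesis
    unfolding sub_Wt_def box B_set_snoc_skip[OF js'(1)] js'(2) desc
    using fin old notin by (cases "v (Suc ?i) < v ?i") (simp_all add: mult_ac)
qed

lemma sub_Wt_snoc_take: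
  assumes js: "set js \<subseteq> {..<length ds}"
  shows "sub_Wt \<beta> n a b (ds @ [d]) (js @ [length ds]) = box_wt \<beta> a b d * sub_Wt \<beta> n a b ds js"
proof -
  have box: "(\<Prod>j \<in> set js. box_wt \<beta> a b ((ds @ [d]) ! j)) = (\<Prod>j \<in> set js. box_wt \<beta> a b (ds ! j))"
    by (rule prod.cong) (use js in \<open>auto simp: nth_append\<close>)
  have old: "(\<Prod>j \<in> B_set \<beta> n ds js. 1 + \<beta> * box_wt \<beta> a b ((ds @ [d]) ! j))
      = (\<Prod>j \<in> B_set \<beta> n ds js. 1 + \<beta> * box_wt \<beta> a b (ds ! j))"
    by (rule prod.cong) (use B_set_subset[of \<beta> n ds js] in \<open>auto simp: nth_append\<close>)
  have "length ds \<notin> set js" using js by auto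
  then have "(\<Prod>j \<in> set (js @ [length ds]). box_wt \<beta> a b ((ds @ [d]) ! j))
      = box_wt \<beta> a b d * (\<Prod>j \<in> set js. box_wt \<beta> a b (ds ! j))"
    by (simp add: box)
  then show ?thesis
    unfolding sub_Wt_def B_set_snoc_take[OF js] old by (simp add: mult.assoc)
qed

text \<open>This is the recursion for coefficients under right multiplication by 1 + wt(d) u_d. At a
  descent, skipping the box contributes the factor 1 + \<beta> wt(d) and taking it contributes wt(d)
  times the sum for v s_d; at an ascent nothing changes.\<close>

lemma subword_sum_snoc:
  assumes ds: "box_index ` set (ds @ [d]) \<subseteq> {1..<n}" and \<beta>: "\<And>k. \<beta> ^ k \<noteq> 0"
  shows "subword_sum a b (ds @ [d]) v = subword_sum a b ds v
    + box_wt \<beta> a b d * hecke_act \<beta> (box_index d) (subword_sum a b ds) v"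
proof (cases "v permutes {1..n}")
  case v: True
  let ?i = "box_index d" and ?x = "box_wt \<beta> a b d" and ?N = "length ds"
  let ?W = "sub_Wt \<beta> n a b"
  have skip: "(\<Sum>js \<in> RSub n ds v. ?W (ds @ [d]) js)
      = subword_sum a b ds v * (if v (Suc ?i) < v ?i then 1 + \<beta> * ?x else 1)"
    unfolding subword_sum_def sum_distrib_right
    by (rule sum.cong[OF refl]) (rule sub_Wt_snoc_skip[OF ds v _ \<beta>])
  show ?thesis
  proof (cases "v (Suc ?i) < v ?i")
    case False
    then show ?thesis
      using skip by (simp add: subword_sum_def RSub_snoc[OF ds v] hecke_act_def)
  next
    case True
    let ?T = "RSub n ds (v \<circ> simple_refl ?i)"
    have disj: "RSub n ds v \<inter> (\<lambda>js. js @ [?N]) ` ?T = {}"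
      by (auto simp: RSub_def)
    have "(\<Sum>js \<in> (\<lambda>js. js @ [?N]) ` ?T. ?W (ds @ [d]) js) = (\<Sum>js \<in> ?T. ?W (ds @ [d]) (js @ [?N]))"
      by (rule sum.reindex_cong[of "\<lambda>js. js @ [?N]"]) (auto simp: inj_on_def)
    also have "\<dots> = ?x * subword_sum a b ds (v \<circ> simple_refl ?i)"
      unfolding subword_sum_def sum_distrib_left
      by (rule sum.cong[OF refl], rule sub_Wt_snoc_take) (simp add: RSub_def)
    finally have take: "(\<Sum>js \<in> (\<lambda>js. js @ [?N]) ` ?T. ?W (ds @ [d]) js)
      = ?x * subword_sum a b ds (v \<circ> simple_refl ?i)" .
    have "subword_sum a b (ds @ [d]) v = (\<Sum>js \<in> RSub n ds v. ?W (ds @ [d]) js)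
        + (\<Sum>js \<in> (\<lambda>js. js @ [?N]) ` ?T. ?W (ds @ [d]) js)"
      unfolding subword_sum_def[of a b "ds @ [d]"] RSub_snoc[OF ds v]
      using True by (simp add: sum.union_disjoint[OF finite_RSub _ disj] finite_RSub)
    then show ?thesis
      unfolding skip take using True by (simp add: hecke_act_def algebra_simps)
  qed
next
  case False
  have i: "box_index d \<in> {1..<n}" and ds': "box_index ` set ds \<subseteq> {1..<n}" using ds by auto
  have "\<not> v \<circ> simple_refl (box_index d) permutes {1..n}"
    using False permutes_comp_simple_refl[OF _ i, of "v \<circ> simple_refl (box_index d)"] by auto
  then show ?thesis
    using False subword_sum_not_permutes[OF ds] subword_sum_not_permutes[OF ds']
    by (simp add: hecke_act_def)
qed

text \<open>Appending a box changes the product and the subword sums by the same recursion, and both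
  start at the indicator of the identity.\<close>

lemma prod_box_elt_eq_expansion:
  assumes \<beta>: "\<And>k. \<beta> ^ k \<noteq> 0"
  shows "box_index ` set ds \<subseteq> {1..<n} \<Longrightarrow>
    prodl (map (box_elt a b) ds) = expansion (subword_sum a b ds)"
proof (induction ds rule: rev_induct)
  case Nil
  have "subword_sum a b [] = (\<lambda>v. of_bool (v = id))"
    by (rule ext) (rule subword_sum_Nil)
  then show ?case using expansion_delta by simp
next
  case (snoc d ds)
  let ?i = "box_index d" and ?x = "box_wt \<beta> a b d" and ?f = "subword_sum a b ds"
  have i: "?i \<in> {1..<n}" and ds: "box_index ` set ds \<subseteq> {1..<n}" using snoc.prems by auto
  note c = gen_closed[OF i] scal_closed[of ?x] expansion_closed[of ?f]
  have boxes: "set (map (box_elt a b) ds) \<subseteq> carrier R" "box_elt a b d \<in> carrier R"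
    using ds i by (auto simp: box_elt_def intro!: h_elt_closed)
  have "prodl (map (box_elt a b) (ds @ [d])) = expansion ?f \<odot> h ?i ?x"
    using ring_prod_list_append[OF boxes(1), of "[box_elt a b d]"] boxes(2) snoc.IH[OF ds]
    by (simp add: box_elt_def[of a b d])
  also have "\<dots> = expansion ?f \<oplus>\<^bsub>R\<^esub> expansion ?f \<odot> (scal \<beta> n ?x \<odot> gen \<beta> n ?i)"
    unfolding h_elt_def using c by (simp add: r_distr del: atLeastLessThan_iff)
  also have "expansion ?f \<odot> (scal \<beta> n ?x \<odot> gen \<beta> n ?i) = scal \<beta> n ?x \<odot> (expansion ?f \<odot> gen \<beta> n ?i)"
    using c by (metis m_assoc scal_central)
  also have "\<dots> = expansion (\<lambda>v. ?x * hecke_act \<beta> ?i ?f v)"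
    by (simp only: expansion_mult_gen[OF i] expansion_scale)
  also have "expansion ?f \<oplus>\<^bsub>R\<^esub> \<dots> = expansion (\<lambda>v. ?f v + ?x * hecke_act \<beta> ?i ?f v)"
    by (rule expansion_add[symmetric])
  also have "\<dots> = expansion (subword_sum a b (ds @ [d]))"
    using subword_sum_snoc[OF snoc.prems \<beta>, of a b]
    by (intro arg_cong[of _ _ expansion]) (simp add: fun_eq_iff)
  finally show ?case .
qed

lemma double_grothendieck_eq_subword_sum:
  assumes "\<beta> \<noteq> 0" "\<And>i. i \<in> {1..<n} \<Longrightarrow> 1 + \<beta> * b i \<noteq> 0" "1 \<le> n"
  shows "double_grothendieck \<beta> n w a b = (\<Sum>js \<in> RSub n (Delta n) w. sub_Wt \<beta> n a b (Delta n) js)"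
proof -
  have \<beta>: "\<beta> ^ k \<noteq> 0" for k using assms(1) by simp
  have ds: "box_index ` set (Delta n) \<subseteq> {1..<n}"
    by (auto simp: Delta_def box_index_def simp del: upt_Suc)
  have "double_grothendieck \<beta> n w a b = alg_coeff \<beta> n (expansion (subword_sum a b (Delta n))) w"
    unfolding double_grothendieck_def
    by (simp only: G_elt_inverse_mult[OF assms(2,3)] prod_box_elt_eq_expansion[OF \<beta> ds])
  also have "\<dots> = subword_sum a b (Delta n) w"
    using alg_coeff_expansion[of "subword_sum a b (Delta n)"] subword_sum_not_permutes[OF ds] by simp
  finally show ?thesis by (simp only: subword_sum_def)
qed

end

section \<open>Specialisation to indeterminates\<close>

lemma beta_nonzero: "beta \<noteq> 0"
  by (simp add: beta_def indet_def Zero_fract_def eq_fract)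

lemma one_plus_beta_bvar_nonzero: "1 + beta * bvar i \<noteq> 0"
proof -
  let ?x = "\<lambda>k. Poly_Mapping.single (Poly_Mapping.single k 1) 1 :: (nat \<Rightarrow>\<^sub>0 nat) \<Rightarrow>\<^sub>0 int"
  let ?p = "1 + ?x 0 * ?x (2 * i + 2)"
  \<comment> \<open>The monomial of \<beta> b_i has a positive exponent at the variable \<beta>, so
    it is not the constant monomial and the constant coefficient of the polynomial stays 1.\<close>
  have "Poly_Mapping.lookup (Poly_Mapping.single 0 1 + Poly_Mapping.single (2 * i + 2) 1 :: nat \<Rightarrow>\<^sub>0 nat) 0 \<noteq> 0"
    by (simp add: lookup_add lookup_single)
  then have "(Poly_Mapping.single 0 1 + Poly_Mapping.single (2 * i + 2) 1 :: nat \<Rightarrow>\<^sub>0 nat) \<noteq> 0"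
    by (metis lookup_zero)
  then have "Poly_Mapping.lookup ?p 0 = 1"
    by (simp add: mult_single lookup_add lookup_single lookup_one)
  then have "?p \<noteq> 0" by (metis lookup_zero zero_neq_one)
  moreover have "1 + beta * bvar i = Fract ?p 1"
    by (simp add: beta_def bvar_def indet_def One_fract_def)
  ultimately show ?thesis by (simp add: Zero_fract_def eq_fract)
qed

theorem theorem4:
  fixes n :: nat and w :: "nat \<Rightarrow> nat"
  assumes "n \<ge> 2" and "w permutes {1..n}"
  shows "double_grothendieck beta n w avar bvar =
    (\<Sum>js \<in> RSub n (Delta n) w. sub_Wt beta n avar bvar (Delta n) js)"
  by (rule id_coxeter_algebra_field.double_grothendieck_eq_subword_sum)
    (use assms(1) beta_nonzero one_plus_beta_bvar_nonzero in auto)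

end
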